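(* Let $\Omega\subseteq\mathbb{R}$ be compact and $s\in\mathbb{N}_0$. Suppose that $\{x_{n,m}\}_{n\in I,\,0\le m\le s}\subseteq\mathbb{R}$ is a bunched sampling set with density $\delta$ and bunch width $h=\tau\delta$, where $\tau\in(0,1]$. If $$\delta<\frac{\tilde H_{s,\tau}(1)}{m_\Omega},$$ where $\tilde H_{s,\tau}$ is the inverse function of $$\tilde h_{s,\tau}(z)=\frac{(1+\tau)^sz^{s+1}}{(s+1)!}\left(1+4z/\pi\right),\qquad z\in(0,\infty),$$ then $$A\|f\|^2\le\sum_{n\in I}\|\mathcal{P}_n(f)\|^2\le B\|f\|^2,\qquad\forall f\in\mathrm{B}(\Omega),$$ where $$A\ge\left(1-\frac{(1+\tau)^s(\delta m_\Omega)^{s+1}}{(s+1)!}\left(1+\frac{4\delta m_\Omega}{\pi}\right)\right)^2,\qquad B\le\left(1+\frac{(1+\tau)^s(\delta m_\Omega)^{s+1}}{(s+1)!}\left(1+\frac{4\delta m_\Omega}{\pi}\right)\right)^2.$$ Equivalently, the set $\{\mathcal{P}_n\}_{n\in I}$ is a non-orthogonal fusion frame for $\mathrm{B}(\Omega)$ with weights $v_n=1$.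
   Context: $\|\cdot\|$ is the norm of $L^2(\mathbb{R})$; $\hat f(\omega)=\int_{\mathbb{R}}f(x)e^{-i\omega x}\,\mathrm{d}x$; $\mathrm{B}(\Omega)=\{f\in L^2(\mathbb{R}):\operatorname{supp}(\hat f)\subseteq\Omega\}$ (smooth representatives are used); $m_\Omega=\sup_{\omega\in\Omega}|\omega|$. Bunched sampling set: $I$ is a countable index set, the points $\{x_{n,0}\}_{n\in I}\subseteq\mathbb{R}$ have density $\delta=\sup_{x\in\mathbb{R}}\inf_{n\in I}|x-x_{n,0}|$, with Voronoi regions $V_n=\{x\in\mathbb{R}:|x-x_{n,0}|\le|x-x_{l,0}|\ \forall l\in I,\ l\neq n\}$, which are assumed to form a partition of $\mathbb{R}$ (up to Lebesgue-null sets). For each $n\in I$ there are $s$ additional points $x_{n,m}\in[x_{n,0}-h_n,x_{n,0}+h_n]\subseteq V_n$, $m=1,\dots,s$, such that $x_{n,0},\dots,x_{n,s}$ are distinct. The bunch width is $h=\sup_{n\in I}h_n$, written $h=\tau\delta$ with $0<\tau\le1$. Operators: for $f\in\mathrm{B}(\Omega)$, $\mathcal{P}_n(f)=p_n(f)\,\mathbb{I}_{V_n}$, where $\mathbb{I}_{V_n}$ is the indicator function of $V_n$ and $p_n(f)$ is the unique polynomial of degree at most $s$ with $p_n(f)(x_{n,m})=f(x_{n,m})$, $m=0,\dots,s$. Given operators (non-orthogonal projections) $\{\mathcal{P}_n\}$ and weights $v_n>0$, they form a non-orthogonal fusion frame for $\mathrm{B}(\Omega)$ if there exist $A,B>0$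 with $A\|f\|^2\le\sum_nv_n\|\mathcal{P}_nf\|^2\le B\|f\|^2$ for all $f\in\mathrm{B}(\Omega)$. *)

theory Defs
  imports "HOL-Analysis.Analysis" "HOL-Computational_Algebra.Polynomial"
begin

definition square_integrable :: "(real \<Rightarrow> complex) \<Rightarrow> bool" where
  "square_integrable f \<longleftrightarrow>
     f \<in> borel_measurable lborel \<and> integrable lborel (\<lambda>x. (norm (f x))\<^sup>2)"

definition L2_norm :: "(real \<Rightarrow> complex) \<Rightarrow> real" where
  "L2_norm f = sqrt (LINT x|lborel. (norm (f x))\<^sup>2)"

definition fourier_integral :: "real \<Rightarrow> (real \<Rightarrow> complex) \<Rightarrow> real \<Rightarrow> complex" where
  "fourier_integral R f \<omega> =
     (LINT x:{-R..R}|lborel. f x * exp (- \<i> * complex_of_real (\<omega> * x)))"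

(* An L2 function need not be integrable, so its Fourier transform is the L2 limit of the
   truncated integrals over [-R, R] (Plancherel).  It is determined up to null sets, hence a
   relation: g represents the transform of f.  The error is an extended nonnegative integral,
   so that it cannot vanish by failing to be integrable. *)
definition has_L2_fourier_transform :: "(real \<Rightarrow> complex) \<Rightarrow> (real \<Rightarrow> complex) \<Rightarrow> bool" where
  "has_L2_fourier_transform f g \<longleftrightarrow>
     square_integrable f \<and> square_integrable g \<and>
     ((\<lambda>R. \<integral>\<^sup>+ \<omega>. ennreal ((norm (g \<omega> - fourier_integral R f \<omega>))\<^sup>2) \<partial>lborel) \<longlongrightarrow> 0) at_top"

(* The support of a class modulo null sets: independent of the representative. *)
definition ess_support :: "(real \<Rightarrow> complex) \<Rightarrow> real set" where
  "ess_support g = - \<Union> {U. open U \<and> (AE \<omega> in lborel. \<omega> \<in> U \<longrightarrow> g \<omega> = 0)}"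

definition smooth :: "(real \<Rightarrow> complex) \<Rightarrow> bool" where
  "smooth f \<longleftrightarrow>
     (\<exists>D. D 0 = f \<and> (\<forall>k x. (D k has_vector_derivative D (Suc k) x) (at x)))"

(* The elements are genuine functions: the smooth representatives of the L2 classes,
   so that point values make sense. *)
definition bandlimited :: "real set \<Rightarrow> (real \<Rightarrow> complex) set" where
  "bandlimited \<Omega> =
     {f. square_integrable f \<and> smooth f \<and>
         (\<exists>g. has_L2_fourier_transform f g \<and> ess_support g \<subseteq> \<Omega>)}"

(* The supremum in [0, \<infinity>], so that it is 0 for the empty set. *)
definition max_freq :: "real set \<Rightarrow> ennreal" where
  "max_freq \<Omega> = (SUP \<omega>\<in>\<Omega>. ennreal \<bar>\<omega>\<bar>)"

definition sampling_density :: "'i set \<Rightarrow> ('i \<Rightarrow> real) \<Rightarrow> ennreal" where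
  "sampling_density I c = (SUP y. INF n\<in>I. ennreal \<bar>y - c n\<bar>)"

definition voronoi :: "'i set \<Rightarrow> ('i \<Rightarrow> real) \<Rightarrow> 'i \<Rightarrow> real set" where
  "voronoi I c n = {y. \<forall>l\<in>I. l \<noteq> n \<longrightarrow> \<bar>y - c n\<bar> \<le> \<bar>y - c l\<bar>}"

(* x n 0 is the centre of the n-th bunch, x n 1, ..., x n s are its additional points,
   r n is the half-width h_n.  Density and width are suprema in [0, \<infinity>]; equating them with
   real numbers makes them finite. *)
definition bunched_sampling_set ::
    "'i set \<Rightarrow> nat \<Rightarrow> ('i \<Rightarrow> nat \<Rightarrow> real) \<Rightarrow> ('i \<Rightarrow> real) \<Rightarrow> real \<Rightarrow> real \<Rightarrow> bool" where
  "bunched_sampling_set I s x r \<delta> h \<longleftrightarrow>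
     countable I \<and>
     0 \<le> \<delta> \<and> sampling_density I (\<lambda>n. x n 0) = ennreal \<delta> \<and>
     (\<forall>n\<in>I. \<forall>l\<in>I. n \<noteq> l \<longrightarrow>
        voronoi I (\<lambda>n. x n 0) n \<inter> voronoi I (\<lambda>n. x n 0) l \<in> null_sets lborel) \<and>
     - (\<Union>n\<in>I. voronoi I (\<lambda>n. x n 0) n) \<in> null_sets lborel \<and>
     (\<forall>n\<in>I. 0 \<le> r n \<and>
        {x n 0 - r n .. x n 0 + r n} \<subseteq> voronoi I (\<lambda>n. x n 0) n \<and>
        (\<forall>m\<in>{1..s}. x n m \<in> {x n 0 - r n .. x n 0 + r n}) \<and>
        inj_on (x n) {..s}) \<and>
     0 \<le> h \<and> (SUP n\<in>I. ennreal (r n)) = ennreal h"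

definition interp_poly :: "nat \<Rightarrow> (nat \<Rightarrow> real) \<Rightarrow> (real \<Rightarrow> complex) \<Rightarrow> complex poly" where
  "interp_poly s t f =
     (THE p. degree p \<le> s \<and> (\<forall>m\<le>s. poly p (complex_of_real (t m)) = f (t m)))"

definition sampling_proj ::
    "'i set \<Rightarrow> nat \<Rightarrow> ('i \<Rightarrow> nat \<Rightarrow> real) \<Rightarrow> 'i \<Rightarrow> (real \<Rightarrow> complex) \<Rightarrow> real \<Rightarrow> complex" where
  "sampling_proj I s x n f =
     (\<lambda>y. poly (interp_poly s (x n) f) (complex_of_real y) *
          indicator (voronoi I (\<lambda>n. x n 0) n) y)"

(* A linear idempotent operator, not necessarily orthogonal; its values need not lie in S. *)
definition projection_on ::
    "(real \<Rightarrow> complex) set \<Rightarrow> ((real \<Rightarrow> complex) \<Rightarrow> real \<Rightarrow> complex) \<Rightarrow> bool" where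
  "projection_on S P \<longleftrightarrow>
     (\<forall>f\<in>S. \<forall>g\<in>S. \<forall>a b. P (\<lambda>y. a * f y + b * g y) = (\<lambda>y. a * P f y + b * P g y)) \<and>
     (\<forall>f\<in>S. P (P f) = P f)"

(* Square integrability and summability are explicit because integrals and infinite sums
   are total: they would be 0 otherwise. *)
definition fusion_frame_bounds ::
    "(real \<Rightarrow> complex) set \<Rightarrow> 'i set \<Rightarrow> ('i \<Rightarrow> (real \<Rightarrow> complex) \<Rightarrow> real \<Rightarrow> complex) \<Rightarrow>
     ('i \<Rightarrow> real) \<Rightarrow> real \<Rightarrow> real \<Rightarrow> bool" where
  "fusion_frame_bounds S I P v A B \<longleftrightarrow>
     0 < A \<and> 0 < B \<and>
     (\<forall>f\<in>S. (\<forall>n\<in>I. square_integrable (P n f)) \<and>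
        (\<lambda>n. v n * (L2_norm (P n f))\<^sup>2) summable_on I \<and>
        A * (L2_norm f)\<^sup>2 \<le> (\<Sum>\<^sub>\<infinity>n\<in>I. v n * (L2_norm (P n f))\<^sup>2) \<and>
        (\<Sum>\<^sub>\<infinity>n\<in>I. v n * (L2_norm (P n f))\<^sup>2) \<le> B * (L2_norm f)\<^sup>2)"

definition nonorthogonal_fusion_frame ::
    "(real \<Rightarrow> complex) set \<Rightarrow> 'i set \<Rightarrow> ('i \<Rightarrow> (real \<Rightarrow> complex) \<Rightarrow> real \<Rightarrow> complex) \<Rightarrow>
     ('i \<Rightarrow> real) \<Rightarrow> bool" where
  "nonorthogonal_fusion_frame S I P v \<longleftrightarrow>
     (\<forall>n\<in>I. 0 < v n \<and> projection_on S (P n)) \<and> (\<exists>A B. fusion_frame_bounds S I P v A B)"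

definition h_tilde :: "nat \<Rightarrow> real \<Rightarrow> real \<Rightarrow> real" where
  "h_tilde s \<tau> z = (1 + \<tau>) ^ s * z ^ (s + 1) / fact (s + 1) * (1 + 4 * z / pi)"

definition H_tilde :: "nat \<Rightarrow> real \<Rightarrow> real \<Rightarrow> real" where
  "H_tilde s \<tau> = the_inv_into {0<..} (h_tilde s \<tau>)"

end

theory Submission
  imports Defs "HOL-Probability.Characteristic_Functions"
begin

text \<open>Write \<open>\<eta>\<close> for the quantity subtracted from 1 in the lower bound, \<open>V\<^sub>n\<close> for the Voronoi regions
and \<open>p\<^sub>n\<close> for the interpolant of \<open>f\<close> in the \<open>n\<close>-th bunch. The regions partition the line up to null
sets, so the sum of the squared norms of the \<open>P\<^sub>n f\<close> is the squared norm of the piecewise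
polynomial that equals \<open>p\<^sub>n\<close> on \<open>V\<^sub>n\<close>. If this function is within \<open>\<eta> \<parallel>f\<parallel>\<close> of \<open>f\<close> in L2, the
triangle inequality gives the bounds \<open>(1 - \<eta>)\<^sup>2\<close> and \<open>(1 + \<eta>)\<^sup>2\<close>, and the condition on \<open>\<delta>\<close> says
precisely that \<open>\<eta> < 1\<close> (\<open>h_tilde_less_one\<close>).

The distance is estimated region by region. On \<open>V\<^sub>n\<close>, an interval of length at most \<open>2 \<delta>\<close>, the
classical error formula (\<open>interpolation_error\<close>) bounds \<open>\<bar>f - p\<^sub>n\<bar>\<close> by \<open>(1 + \<tau>)\<^sup>s \<delta>\<^sup>s\<^sup>+\<^sup>1 / (s + 1)!\<close> times
the maximum of \<open>\<bar>f\<^sup>(\<^sup>s\<^sup>+\<^sup>1\<^sup>)\<bar>\<close> over \<open>V\<^sub>n\<close>. The step function formed by these maxima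
differs from \<open>\<bar>f\<^sup>(\<^sup>s\<^sup>+\<^sup>1\<^sup>)\<bar>\<close> by at most the oscillation of the derivative about its value at a
maximiser, and Wirtinger's inequality on both sides of the maximiser (\<open>oscillation_bound\<close>) bounds
the L2 norm of that oscillation by \<open>4 \<delta> / \<pi>\<close> times that of \<open>f\<^sup>(\<^sup>s\<^sup>+\<^sup>2\<^sup>)\<close>. Bernstein's inequality
\<open>\<parallel>f\<^sup>(\<^sup>k\<^sup>)\<parallel> \<le> m\<^sup>k \<parallel>f\<parallel>\<close> turns both terms into multiples of \<open>\<parallel>f\<parallel>\<close>, and their sum is \<open>\<eta> \<parallel>f\<parallel>\<close>.

Bernstein's inequality rests on Gaussian damping, which gives the one-sided bound \<open>\<parallel>fourier u\<parallel>\<^sup>2 \<le> 2 \<pi> \<parallel>u\<parallel>\<^sup>2\<close> (\<open>fourier_norm_le\<close>) and the inversion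
formula for a continuous \<open>f\<close> (\<open>L2_fourier_inversion\<close>). With \<open>g\<close> the transform of \<open>f\<close>, the bound
applied to \<open>f\<close> controls \<open>g\<close>; inversion, differentiated under the integral sign, represents
\<open>f\<^sup>(\<^sup>k\<^sup>)\<close> as the inverse transform of \<open>(\<i> \<omega>)\<^sup>k g \<omega>\<close>; and the bound applied to that function controls
\<open>f\<^sup>(\<^sup>k\<^sup>)\<close>. The two factors \<open>2 \<pi>\<close> cancel against the factor \<open>1 / (2 \<pi>)\<close> of the inversion formula.

The L2 triangle inequality enters in weighted form: the bound
\<open>(a + b)\<^sup>2 \<le> (1 + t) a\<^sup>2 + (1 + 1 / t) b\<^sup>2\<close> is integrated and summed for each \<open>t > 0\<close>, and the best
\<open>t\<close> is chosen at the end (\<open>le_power2_sum_if_le_weighted\<close>). Being linear in the squares, it passes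
from single regions to the whole line.\<close>

section \<open>Weighted bounds for squares of sums\<close>

lemma sum_power2_le_weighted:
  fixes a b t :: real
  assumes "0 < t"
  shows "(a + b)\<^sup>2 \<le> (1 + t) * a\<^sup>2 + (1 + 1 / t) * b\<^sup>2"
proof -
  have "0 \<le> (t * a - b)\<^sup>2 / t" using assms by simp
  also have "\<dots> = t * a\<^sup>2 + b\<^sup>2 / t - 2 * a * b"
    using assms by (simp add: field_simps power2_eq_square)
  finally show ?thesis using assms by (simp add: field_simps power2_eq_square)
qed

lemma norm_power2_le_weighted:
  fixes a b :: "'a::real_normed_vector"
  assumes "0 < t"
  shows "(norm a)\<^sup>2 \<le> (1 + t) * (norm b)\<^sup>2 + (1 + 1 / t) * (norm (a - b))\<^sup>2"
proof -
  have "norm a \<le> norm b + norm (a - b)" by (metis add.commute diff_add_cancel norm_triangle_ineq)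
  then have "(norm a)\<^sup>2 \<le> (norm b + norm (a - b))\<^sup>2" by (intro power_mono) auto
  then show ?thesis by (rule order_trans) (rule sum_power2_le_weighted[OF assms])
qed

text \<open>For positive \<open>a\<close> and \<open>b\<close> the optimal weight is \<open>t = b / a\<close>. If one of them vanishes, the weight
tends to \<open>0\<close> or to infinity. This recovers the triangle inequality from the weighted bounds.\<close>
lemma le_power2_sum_if_le_weighted:
  fixes a b X :: real
  assumes a: "0 \<le> a" and b: "0 \<le> b" and le: "\<And>t. 0 < t \<Longrightarrow> X \<le> (1 + t) * a\<^sup>2 + (1 + 1 / t) * b\<^sup>2"
  shows "X \<le> (a + b)\<^sup>2"
proof -
  consider "b = 0" | "a = 0" | "0 < a" "0 < b" using a b by force
  then show ?thesis
  proof cases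
    case 1
    have "((\<lambda>t. (1 + t) * a\<^sup>2) \<longlongrightarrow> (1 + 0) * a\<^sup>2) (at_right 0)" by (intro tendsto_intros)
    then show ?thesis
      using le 1 by (intro tendsto_lowerbound[where F = "at_right 0" and f = "\<lambda>t. (1 + t) * a\<^sup>2"])
        (auto simp: eventually_at_right_field intro!: exI[of _ 1])
  next
    case 2
    have "((\<lambda>t. (1 + 1 / t) * b\<^sup>2) \<longlongrightarrow> (1 + 0) * b\<^sup>2) at_top"
      by (intro tendsto_intros tendsto_divide_0[OF tendsto_const] filterlim_at_top_imp_at_infinity filterlim_ident)
    then show ?thesis
      using le 2 by (intro tendsto_lowerbound[where F = at_top and f = "\<lambda>t. (1 + 1 / t) * b\<^sup>2"])
        (auto intro!: eventually_mono[OF eventually_gt_at_top[of 0]])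
  next
    case 3
    have "(1 + b / a) * a\<^sup>2 + (1 + 1 / (b / a)) * b\<^sup>2 = (a + b)\<^sup>2"
      using 3 by (simp add: field_simps power2_eq_square)
    then show ?thesis using le[of "b / a"] 3 by simp
  qed
qed

text \<open>Through this bound, square integrability gives integrability against any bounded integrable factor.\<close>
lemma norm_le_one_plus_power2: "norm a \<le> 1 + (norm a)\<^sup>2"
  using zero_le_power2[of "norm a - 1"] norm_ge_zero[of a] unfolding power2_diff one_power2 mult_1_right by linarith

section \<open>The Fourier integral and Gaussian kernels\<close>

definition fourier :: "(real \<Rightarrow> complex) \<Rightarrow> real \<Rightarrow> complex" where
  "fourier u \<omega> = (LINT x|lborel. u x * cis (- (\<omega> * x)))"

text \<open>A Gaussian with value 1 at the origin, which tends to 1 everywhere as \<open>k\<close> grows: inserted into a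
Fourier integral it makes all integrals converge absolutely.\<close>
definition damp :: "real \<Rightarrow> real \<Rightarrow> real" where
  "damp k \<omega> = exp (- (\<omega> / k)\<^sup>2 / 2)"

text \<open>The normal density with standard deviation \<open>1 / k\<close>, an approximate identity as \<open>k\<close> grows.\<close>
definition gauss_kernel :: "real \<Rightarrow> real \<Rightarrow> real" where
  "gauss_kernel k y = k * std_normal_density (k * y)"

lemma borel_measurable_cis [measurable]: "cis \<in> borel_measurable borel"
  by (intro borel_measurable_continuous_onI continuous_intros)

lemma borel_measurable_cnj [measurable]: "cnj \<in> borel_measurable borel"
  by (intro borel_measurable_continuous_onI continuous_intros)

lemma damp_measurable [measurable]: "damp k \<in> borel_measurable borel"
  unfolding damp_def by measurable

lemma gauss_kernel_measurable [measurable]: "gauss_kernel k \<in> borel_measurable borel"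
  unfolding gauss_kernel_def by measurable

lemma gauss_kernel_minus: "gauss_kernel k (a - b) = gauss_kernel k (b - a)"
  by (simp add: gauss_kernel_def normal_density_def power2_eq_square algebra_simps)

lemma gauss_kernel_nonneg: "0 \<le> k \<Longrightarrow> 0 \<le> gauss_kernel k y"
  by (simp add: gauss_kernel_def)

lemma gauss_kernel_le:
  assumes "0 < k"
  shows "gauss_kernel k y \<le> k"
proof -
  have "1 \<le> sqrt (2 * pi)" using pi_ge_two by simp
  then have "std_normal_density (k * y) \<le> 1"
    unfolding normal_density_def by (intro mult_le_one) auto
  then show ?thesis using assms by (simp add: gauss_kernel_def)
qed

lemma gauss_kernel_integral:
  assumes "0 < k"
  shows "integrable lborel (\<lambda>y. gauss_kernel k (y - a))"
    and "(LINT y|lborel. gauss_kernel k (y - a)) = 1"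
proof -
  have i: "integrable lborel std_normal_density" by simp
  have "integrable lborel (\<lambda>y. k * std_normal_density (- (k * a) + k * y))"
    using assms lborel_integrable_real_affine[OF i, of k "- (k * a)"] by (intro integrable_mult_right) simp
  then show "integrable lborel (\<lambda>y. gauss_kernel k (y - a))"
    by (simp add: gauss_kernel_def algebra_simps)
  have "1 = (LINT y|lborel. std_normal_density y)" by simp
  also have "\<dots> = k * (LINT y|lborel. std_normal_density (- (k * a) + k * y))"
    using assms lborel_integral_real_affine[of k std_normal_density "- (k * a)"] by simp
  also have "\<dots> = (LINT y|lborel. gauss_kernel k (y - a))"
    by (simp add: gauss_kernel_def algebra_simps)
  finally show "(LINT y|lborel. gauss_kernel k (y - a)) = 1" by simp
qed

lemma damp_eq_gauss: "0 < k \<Longrightarrow> damp k \<omega> = sqrt (2 * pi) * k * gauss_kernel (1 / k) \<omega>"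
  by (simp add: damp_def gauss_kernel_def normal_density_def field_simps)

lemma damp_integrable: "0 < k \<Longrightarrow> integrable lborel (damp k)"
  using gauss_kernel_integral(1)[of "1/k" 0]
  by (subst Bochner_Integration.integrable_cong[OF refl damp_eq_gauss]) (auto intro!: integrable_mult_right)

lemma damp_bounds: "0 < damp k \<omega>" "damp k \<omega> \<le> 1"
  by (auto simp: damp_def)

text \<open>After the substitution \<open>\<omega> = k x\<close> this is the characteristic function of the standard normal
distribution.\<close>
lemma damp_fourier:
  assumes "0 < k"
  shows "(LINT \<omega>|lborel. complex_of_real (damp k \<omega>) * cis (\<omega> * y)) = complex_of_real (2 * pi * gauss_kernel k y)"
proof -
  have "complex_of_real (exp (- (k * y)\<^sup>2 / 2)) = char std_normal_distribution (k * y)"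
    by (simp add: char_std_normal_distribution)
  also have "\<dots> = (LINT x|lborel. std_normal_density x *\<^sub>R cis (k * y * x))"
    by (simp add: char_def integral_density cis_conv_exp)
  also have "\<dots> = (LINT x|lborel. (1 / sqrt (2 * pi)) *\<^sub>R (complex_of_real (damp k (0 + k * x)) * cis ((0 + k * x) * y)))"
    using assms by (intro Bochner_Integration.integral_cong)
      (auto simp: damp_def normal_density_def scaleR_conv_of_real mult_ac)
  also have "\<dots> = (1 / sqrt (2 * pi)) *\<^sub>R (LINT x|lborel. complex_of_real (damp k (0 + k * x)) * cis ((0 + k * x) * y))"
    by (rule integral_scaleR_right)
  finally have *: "(LINT x|lborel. complex_of_real (damp k (0 + k * x)) * cis ((0 + k * x) * y)) =
      sqrt (2 * pi) * exp (- (k * y)\<^sup>2 / 2)"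
    by (simp add: scaleR_conv_of_real field_simps)
  have "(LINT \<omega>|lborel. complex_of_real (damp k \<omega>) * cis (\<omega> * y)) =
      \<bar>k\<bar> *\<^sub>R (LINT x|lborel. complex_of_real (damp k (0 + k * x)) * cis ((0 + k * x) * y))"
    using assms by (intro lborel_integral_real_affine) auto
  also have "\<dots> = complex_of_real (k * (sqrt (2 * pi) * exp (- (k * y)\<^sup>2 / 2)))"
    unfolding * using assms by (simp add: scaleR_conv_of_real)
  also have "k * (sqrt (2 * pi) * exp (- (k * y)\<^sup>2 / 2)) = 2 * pi * gauss_kernel k y"
  proof -
    have "sqrt (2 * pi) * sqrt (2 * pi) = 2 * pi" by simp
    then have "sqrt (2 * pi) = 2 * pi / sqrt (2 * pi)" by (simp add: real_div_sqrt)
    then show ?thesis unfolding gauss_kernel_def normal_density_def by (simp add: field_simps)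
  qed
  finally show ?thesis .
qed

lemma damp_limit: "(\<lambda>n. damp (real (Suc n)) \<omega>) \<longlonglongrightarrow> 1"
proof -
  have "(\<lambda>n. damp (real (Suc n)) \<omega>) \<longlonglongrightarrow> exp (- 0\<^sup>2 / 2)"
    unfolding damp_def
    by (intro tendsto_intros tendsto_divide_0[OF tendsto_const] filterlim_at_top_imp_at_infinity
        filterlim_compose[OF filterlim_real_sequentially filterlim_Suc]) simp
  then show ?thesis by simp
qed

lemma fourier_measurable [measurable]:
  assumes [measurable]: "u \<in> borel_measurable borel"
  shows "fourier u \<in> borel_measurable borel"
proof -
  have "(\<lambda>\<omega>. LINT x|lborel. u x * cis (- (\<omega> * x))) \<in> borel_measurable borel"
    by (rule lborel.borel_measurable_lebesgue_integral) measurable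
  then show ?thesis by (simp add: fourier_def[abs_def])
qed

lemma norm_fourier_le:
  "norm (fourier u \<omega>) \<le> (LINT x|lborel. norm (u x))"
  unfolding fourier_def by (rule order_trans[OF integral_norm_bound]) (simp add: norm_mult)

lemma integrable_times_bounded:
  fixes u c :: "real \<Rightarrow> complex"
  assumes "integrable lborel u" "c \<in> borel_measurable borel" "\<And>x. norm (c x) \<le> B"
  shows "integrable lborel (\<lambda>x. u x * c x)"
proof (rule Bochner_Integration.integrable_bound)
  show "integrable lborel (\<lambda>x. B * norm (u x))" using assms by auto
  show "(\<lambda>x. u x * c x) \<in> borel_measurable lborel" using assms by auto
  show "AE x in lborel. norm (u x * c x) \<le> norm (B * norm (u x))"
  proof (intro AE_I2)
    fix x
    have "norm (u x * c x) \<le> norm (u x) * B" by (simp add: norm_mult mult_left_mono assms(3))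
    then show "norm (u x * c x) \<le> norm (B * norm (u x))" by (simp add: mult.commute)
  qed
qed

text \<open>Both sides are the double integral of \<open>u x * v \<omega> * cis (- \<omega> x)\<close>, which converges absolutely.\<close>
lemma fourier_multiplication:
  assumes u: "integrable lborel u" and v: "integrable lborel v"
  shows "(LINT \<omega>|lborel. fourier u \<omega> * v \<omega>) = (LINT x|lborel. u x * fourier v x)"
proof -
  have [measurable]: "u \<in> borel_measurable borel" "v \<in> borel_measurable borel"
    using u v by (auto dest: borel_measurable_integrable)
  let ?g = "\<lambda>\<omega> x. u x * v \<omega> * cis (- (\<omega> * x))"
  have int: "integrable (lborel \<Otimes>\<^sub>M lborel) (\<lambda>(\<omega>, x). ?g \<omega> x)"
  proof (rule lborel_pair.Fubini_integrable)
    show "(\<lambda>(\<omega>, x). ?g \<omega> x) \<in> borel_measurable (lborel \<Otimes>\<^sub>M lborel)" by measurable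
    have "integrable lborel (\<lambda>\<omega>. norm (v \<omega>) * (LINT x|lborel. norm (u x)))"
      using v by (intro integrable_mult_left) auto
    then show "integrable lborel (\<lambda>\<omega>. LINT x|lborel. norm (case (\<omega>, x) of (\<omega>, x) \<Rightarrow> ?g \<omega> x))"
      by (simp add: norm_mult mult.commute)
    show "AE \<omega> in lborel. integrable lborel (\<lambda>x. case (\<omega>, x) of (\<omega>, x) \<Rightarrow> ?g \<omega> x)"
    proof (intro AE_I2)
      fix \<omega>
      have "integrable lborel (\<lambda>x. u x * (v \<omega> * cis (- (\<omega> * x))))"
        using u by (rule integrable_times_bounded[where B = "norm (v \<omega>)"]) (auto simp: norm_mult)
      then show "integrable lborel (\<lambda>x. case (\<omega>, x) of (\<omega>, x) \<Rightarrow> ?g \<omega> x)"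
        by (simp add: mult.assoc)
    qed
  qed
  have "(LINT \<omega>|lborel. fourier u \<omega> * v \<omega>) = (LINT \<omega>|lborel. LINT x|lborel. ?g \<omega> x)"
    unfolding fourier_def
    by (subst integral_mult_left_zero[symmetric]) (simp add: mult_ac)
  also have "\<dots> = (LINT x|lborel. LINT \<omega>|lborel. ?g \<omega> x)"
    using lborel_pair.Fubini_integral[OF int] by simp
  also have "\<dots> = (LINT x|lborel. u x * fourier v x)"
    unfolding fourier_def
    by (subst integral_mult_right_zero[symmetric]) (simp add: mult_ac)
  finally show ?thesis .
qed

lemma fourier_damped_cis:
  assumes "0 < k"
  shows "fourier (\<lambda>\<omega>. complex_of_real (damp k \<omega>) * cis (\<omega> * a)) x = complex_of_real (2 * pi * gauss_kernel k (x - a))"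
proof -
  have "complex_of_real (damp k \<omega>) * cis (\<omega> * a) * cis (- (x * \<omega>)) = complex_of_real (damp k \<omega>) * cis (\<omega> * (a - x))" for \<omega>
    by (simp add: mult.assoc cis_mult algebra_simps)
  then show ?thesis
    unfolding fourier_def gauss_kernel_minus[of k x a] damp_fourier[OF assms, of "a - x", symmetric]
    by (intro Bochner_Integration.integral_cong) auto
qed

lemma damped_cis_integrable:
  assumes "0 < k"
  shows "integrable lborel (\<lambda>\<omega>. complex_of_real (damp k \<omega>) * cis (\<omega> * a))"
  using damp_integrable[OF assms] by (intro integrable_times_bounded[where B = 1]) auto

text \<open>Damping the inversion integral of \<open>u\<close> amounts to smoothing \<open>u\<close> by the Gaussian kernel: this is the
multiplication formula with \<open>v \<omega> = damp k \<omega> * cis (\<omega> a)\<close>.\<close>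
lemma fourier_gaussian_summation:
  fixes u :: "real \<Rightarrow> complex"
  assumes "0 < k" "integrable lborel u"
  shows "(LINT \<omega>|lborel. fourier u \<omega> * (complex_of_real (damp k \<omega>) * cis (\<omega> * a))) =
    2 * pi * (LINT x|lborel. u x * complex_of_real (gauss_kernel k (x - a)))"
proof -
  have "(LINT \<omega>|lborel. fourier u \<omega> * (complex_of_real (damp k \<omega>) * cis (\<omega> * a))) =
      (LINT x|lborel. u x * fourier (\<lambda>\<omega>. complex_of_real (damp k \<omega>) * cis (\<omega> * a)) x)"
    by (rule fourier_multiplication[OF assms(2) damped_cis_integrable[OF assms(1)]])
  also have "\<dots> = (LINT x|lborel. complex_of_real (2 * pi) * (u x * complex_of_real (gauss_kernel k (x - a))))"
    by (intro Bochner_Integration.integral_cong refl) (simp add: fourier_damped_cis[OF assms(1)])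
  also have "\<dots> = complex_of_real (2 * pi) * (LINT x|lborel. u x * complex_of_real (gauss_kernel k (x - a)))"
    by (rule integral_mult_right_zero)
  finally show ?thesis by simp
qed

section \<open>The Fourier integral is bounded in L2\<close>

lemma nn_integral_gauss_kernel:
  assumes "0 < k"
  shows "(\<integral>\<^sup>+y. ennreal (gauss_kernel k (y - a)) \<partial>lborel) = 1"
  using assms gauss_kernel_integral[OF assms, of a] by (subst nn_integral_eq_integral) (auto simp: gauss_kernel_nonneg)

text \<open>Bounding \<open>\<bar>u x\<bar> \<bar>u y\<bar>\<close> by \<open>(\<bar>u x\<bar>\<^sup>2 + \<bar>u y\<bar>\<^sup>2) / 2\<close> leaves two integrals in each of which one
variable occurs only in the kernel, and the kernel has integral 1 in either variable.\<close>
lemma gaussian_form_le: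
  fixes u :: "real \<Rightarrow> complex"
  assumes k: "0 < k" and [measurable]: "u \<in> borel_measurable borel"
  shows "(\<integral>\<^sup>+x. \<integral>\<^sup>+y. ennreal (norm (u x) * norm (u y) * gauss_kernel k (y - x)) \<partial>lborel \<partial>lborel)
    \<le> (\<integral>\<^sup>+x. ennreal ((norm (u x))\<^sup>2) \<partial>lborel)"
proof -
  let ?K = "gauss_kernel k"
  let ?h = "\<lambda>x. ennreal ((norm (u x))\<^sup>2 / 2)"
  have pw: "ennreal (norm (u x) * norm (u y) * ?K (y - x)) \<le> ?h x * ennreal (?K (y - x)) + ?h y * ennreal (?K (y - x))" for x y
  proof -
    have "0 \<le> (norm (u x) - norm (u y))\<^sup>2" by simp
    then have "norm (u x) * norm (u y) \<le> (norm (u x))\<^sup>2 / 2 + (norm (u y))\<^sup>2 / 2"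
      unfolding power2_diff by simp
    then have "norm (u x) * norm (u y) * ?K (y - x) \<le> ((norm (u x))\<^sup>2 / 2 + (norm (u y))\<^sup>2 / 2) * ?K (y - x)"
      using k by (intro mult_right_mono gauss_kernel_nonneg) auto
    then show ?thesis
      using k by (simp add: ennreal_mult[symmetric] ennreal_plus[symmetric] gauss_kernel_nonneg distrib_right del: ennreal_plus)
  qed
  have A: "(\<integral>\<^sup>+x. \<integral>\<^sup>+y. ?h x * ennreal (?K (y - x)) \<partial>lborel \<partial>lborel) = (\<integral>\<^sup>+x. ?h x \<partial>lborel)"
    by (simp add: nn_integral_cmult nn_integral_gauss_kernel[OF k])
  have "(\<integral>\<^sup>+x. \<integral>\<^sup>+y. ?h y * ennreal (?K (y - x)) \<partial>lborel \<partial>lborel) = (\<integral>\<^sup>+y. \<integral>\<^sup>+x. ?h y * ennreal (?K (y - x)) \<partial>lborel \<partial>lborel)"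
    by (rule lborel_pair.Fubini'[where f = "\<lambda>y x. ?h y * ennreal (?K (y - x))"]) measurable
  also have "\<dots> = (\<integral>\<^sup>+x. ?h x \<partial>lborel)"
    by (subst gauss_kernel_minus) (simp add: nn_integral_cmult nn_integral_gauss_kernel[OF k])
  finally have B: "(\<integral>\<^sup>+x. \<integral>\<^sup>+y. ?h y * ennreal (?K (y - x)) \<partial>lborel \<partial>lborel) = (\<integral>\<^sup>+x. ?h x \<partial>lborel)" .
  have "(\<integral>\<^sup>+x. \<integral>\<^sup>+y. ennreal (norm (u x) * norm (u y) * ?K (y - x)) \<partial>lborel \<partial>lborel)
      \<le> (\<integral>\<^sup>+x. \<integral>\<^sup>+y. ?h x * ennreal (?K (y - x)) + ?h y * ennreal (?K (y - x)) \<partial>lborel \<partial>lborel)"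
    by (intro nn_integral_mono pw)
  also have "\<dots> = (\<integral>\<^sup>+x. ?h x \<partial>lborel) + (\<integral>\<^sup>+x. ?h x \<partial>lborel)"
    by (simp add: nn_integral_add A B)
  also have "\<dots> = (\<integral>\<^sup>+x. ennreal ((norm (u x))\<^sup>2) \<partial>lborel)"
    by (subst nn_integral_add[symmetric]) (auto intro!: nn_integral_cong simp: ennreal_plus[symmetric] simp del: ennreal_plus)
  finally show ?thesis .
qed

text \<open>Writing \<open>\<bar>fourier u\<bar>\<^sup>2\<close> as \<open>fourier u\<close> times its conjugate and using the multiplication formula twice
moves everything to the space side. There the damped integral equals \<open>2 \<pi>\<close> times the quadratic form
of the Gaussian kernel at \<open>u\<close>.\<close>
lemma fourier_norm_le_damped:
  fixes u :: "real \<Rightarrow> complex"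
  assumes k: "0 < k" and u: "integrable lborel u"
  shows "(\<integral>\<^sup>+\<omega>. ennreal ((norm (fourier u \<omega>))\<^sup>2 * damp k \<omega>) \<partial>lborel)
    \<le> ennreal (2 * pi) * (\<integral>\<^sup>+x. ennreal ((norm (u x))\<^sup>2) \<partial>lborel)"
proof -
  have um [measurable]: "u \<in> borel_measurable borel"
    using u by (auto dest: borel_measurable_integrable)
  let ?C = "LINT x|lborel. norm (u x)"
  define v where "v \<omega> = complex_of_real (damp k \<omega>) * cnj (fourier u \<omega>)" for \<omega>
  have v: "integrable lborel v"
    unfolding v_def using damp_integrable[OF k]
    by (intro integrable_times_bounded[where B = ?C]) (auto simp: norm_fourier_le)
  define w where "w x = (LINT y|lborel. u y * complex_of_real (gauss_kernel k (y - x)))" for x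
  have fv: "fourier v x = 2 * pi * cnj (w x)" for x
  proof -
    have "fourier v x = (LINT \<omega>|lborel. cnj (fourier u \<omega> * (complex_of_real (damp k \<omega>) * cis (\<omega> * x))))"
      unfolding fourier_def[of v] v_def by (simp add: mult_ac cis_cnj)
    also have "\<dots> = cnj (2 * pi * w x)"
      unfolding w_def fourier_gaussian_summation[OF k u, symmetric] by (rule Bochner_Integration.integral_cnj)
    finally show ?thesis by simp
  qed
  have sq: "fourier u \<omega> * v \<omega> = complex_of_real ((norm (fourier u \<omega>))\<^sup>2 * damp k \<omega>)" for \<omega>
    unfolding v_def using complex_norm_square[of "fourier u \<omega>"] by (simp add: mult_ac)
  have int: "integrable lborel (\<lambda>\<omega>. fourier u \<omega> * v \<omega>)"
    using integrable_times_bounded[OF v, of "fourier u" ?C] by (simp add: norm_fourier_le mult.commute)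
  then have int': "integrable lborel (\<lambda>\<omega>. (norm (fourier u \<omega>))\<^sup>2 * damp k \<omega>)"
    unfolding sq by (simp only: complex_of_real_integrable_eq)
  have "(\<integral>\<^sup>+\<omega>. ennreal ((norm (fourier u \<omega>))\<^sup>2 * damp k \<omega>) \<partial>lborel) =
      ennreal (LINT \<omega>|lborel. (norm (fourier u \<omega>))\<^sup>2 * damp k \<omega>)"
    using int' by (intro nn_integral_eq_integral) (auto simp: damp_def)
  also have "(LINT \<omega>|lborel. (norm (fourier u \<omega>))\<^sup>2 * damp k \<omega>) = norm (LINT \<omega>|lborel. fourier u \<omega> * v \<omega>)"
    unfolding sq by (simp only: integral_complex_of_real norm_of_real)
      (subst abs_of_nonneg, auto intro!: integral_nonneg_AE simp: damp_def)
  also have "(LINT \<omega>|lborel. fourier u \<omega> * v \<omega>) = (LINT x|lborel. u x * fourier v x)"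
    by (rule fourier_multiplication[OF u v])
  also have "ennreal (norm \<dots>) \<le> (\<integral>\<^sup>+x. ennreal (norm (u x * fourier v x)) \<partial>lborel)"
    using v by (intro integral_norm_bound_ennreal integrable_times_bounded[OF u, where B = "LINT x|lborel. norm (v x)"])
      (auto simp: norm_fourier_le intro!: fourier_measurable dest: borel_measurable_integrable)
  also have "\<dots> \<le> (\<integral>\<^sup>+x. ennreal (2 * pi) * (\<integral>\<^sup>+y. ennreal (norm (u x) * norm (u y) * gauss_kernel k (y - x)) \<partial>lborel) \<partial>lborel)"
  proof (intro nn_integral_mono)
    fix x
    have "integrable lborel (\<lambda>y. u y * complex_of_real (gauss_kernel k (y - x)))"
    proof (rule integrable_times_bounded[OF u, where B = k])
      fix y
      show "norm (complex_of_real (gauss_kernel k (y - x))) \<le> k"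
        using k by (simp add: gauss_kernel_nonneg gauss_kernel_le)
    qed simp
    then have "ennreal (norm (w x)) \<le> (\<integral>\<^sup>+y. ennreal (norm (u y) * gauss_kernel k (y - x)) \<partial>lborel)"
      unfolding w_def using k by (intro order_trans[OF integral_norm_bound_ennreal]) (auto simp: norm_mult gauss_kernel_nonneg)
    then have "ennreal (norm (u x)) * ennreal (norm (w x)) \<le> ennreal (norm (u x)) * (\<integral>\<^sup>+y. ennreal (norm (u y) * gauss_kernel k (y - x)) \<partial>lborel)"
      by (intro mult_left_mono) auto
    also have "\<dots> = (\<integral>\<^sup>+y. ennreal (norm (u x)) * ennreal (norm (u y) * gauss_kernel k (y - x)) \<partial>lborel)"
      by (rule nn_integral_cmult[symmetric]) measurable
    also have "\<dots> = (\<integral>\<^sup>+y. ennreal (norm (u x) * norm (u y) * gauss_kernel k (y - x)) \<partial>lborel)"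
      using k by (intro nn_integral_cong) (simp add: ennreal_mult[symmetric] gauss_kernel_nonneg mult.assoc)
    finally have "ennreal (2 * pi) * (ennreal (norm (u x)) * ennreal (norm (w x))) \<le> ennreal (2 * pi) * (\<integral>\<^sup>+y. ennreal (norm (u x) * norm (u y) * gauss_kernel k (y - x)) \<partial>lborel)"
      by (intro mult_left_mono) auto
    then show "ennreal (norm (u x * fourier v x)) \<le> ennreal (2 * pi) * (\<integral>\<^sup>+y. ennreal (norm (u x) * norm (u y) * gauss_kernel k (y - x)) \<partial>lborel)"
      by (simp add: fv norm_mult ennreal_mult[symmetric] mult_ac)
  qed
  also have "\<dots> = ennreal (2 * pi) * (\<integral>\<^sup>+x. \<integral>\<^sup>+y. ennreal (norm (u x) * norm (u y) * gauss_kernel k (y - x)) \<partial>lborel \<partial>lborel)"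
    by (rule nn_integral_cmult) measurable
  also have "\<dots> \<le> ennreal (2 * pi) * (\<integral>\<^sup>+x. ennreal ((norm (u x))\<^sup>2) \<partial>lborel)"
    by (intro mult_left_mono gaussian_form_le[OF k um]) auto
  finally show ?thesis .
qed

text \<open>The factor \<open>damp k\<close> increases to 1, so monotone convergence removes it. This is one half of the
Plancherel identity.\<close>
lemma fourier_norm_le:
  fixes u :: "real \<Rightarrow> complex"
  assumes u: "integrable lborel u"
  shows "(\<integral>\<^sup>+\<omega>. ennreal ((norm (fourier u \<omega>))\<^sup>2) \<partial>lborel)
    \<le> ennreal (2 * pi) * (\<integral>\<^sup>+x. ennreal ((norm (u x))\<^sup>2) \<partial>lborel)"
proof (rule LIMSEQ_le_const2)
  have [measurable]: "u \<in> borel_measurable borel"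
    using u by (auto dest: borel_measurable_integrable)
  show "(\<lambda>n. \<integral>\<^sup>+\<omega>. ennreal ((norm (fourier u \<omega>))\<^sup>2 * damp (real (Suc n)) \<omega>) \<partial>lborel)
      \<longlonglongrightarrow> (\<integral>\<^sup>+\<omega>. ennreal ((norm (fourier u \<omega>))\<^sup>2) \<partial>lborel)"
  proof (rule nn_integral_LIMSEQ)
    show "incseq (\<lambda>n \<omega>. ennreal ((norm (fourier u \<omega>))\<^sup>2 * damp (real (Suc n)) \<omega>))"
    proof (intro incseq_SucI le_funI ennreal_leI mult_left_mono)
      fix n \<omega>
      have "\<bar>\<omega> / real (Suc (Suc n))\<bar> \<le> \<bar>\<omega> / real (Suc n)\<bar>"
        by (simp add: abs_divide divide_left_mono)
      then have "(\<omega> / real (Suc (Suc n)))\<^sup>2 \<le> (\<omega> / real (Suc n))\<^sup>2"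
        by (simp only: abs_le_square_iff)
      then show "damp (real (Suc n)) \<omega> \<le> damp (real (Suc (Suc n))) \<omega>"
        by (simp add: damp_def)
    qed auto
    fix \<omega>
    have "(\<lambda>n. (norm (fourier u \<omega>))\<^sup>2 * damp (real (Suc n)) \<omega>) \<longlonglongrightarrow> (norm (fourier u \<omega>))\<^sup>2 * 1"
      by (intro tendsto_intros damp_limit)
    then show "(\<lambda>n. ennreal ((norm (fourier u \<omega>))\<^sup>2 * damp (real (Suc n)) \<omega>)) \<longlonglongrightarrow> ennreal ((norm (fourier u \<omega>))\<^sup>2)"
      by (simp add: tendsto_ennrealI)
  qed measurable
  show "\<exists>N. \<forall>n\<ge>N. (\<integral>\<^sup>+\<omega>. ennreal ((norm (fourier u \<omega>))\<^sup>2 * damp (real (Suc n)) \<omega>) \<partial>lborel)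
      \<le> ennreal (2 * pi) * (\<integral>\<^sup>+x. ennreal ((norm (u x))\<^sup>2) \<partial>lborel)"
    using fourier_norm_le_damped[OF _ u] by auto
qed

section \<open>The L2 Fourier transform\<close>

lemma fourier_integral_eq_fourier:
  "fourier_integral R f = fourier (\<lambda>x. indicator {-R..R} x *\<^sub>R f x)"
  by (simp add: fun_eq_iff fourier_integral_def fourier_def set_lebesgue_integral_def cis_conv_exp)

lemma square_integrable_times_integrable:
  fixes f v :: "real \<Rightarrow> complex"
  assumes f: "square_integrable f" and v: "integrable lborel v" and B: "\<And>x. norm (v x) \<le> B"
  shows "integrable lborel (\<lambda>x. f x * v x)"
proof (rule Bochner_Integration.integrable_bound)
  have [measurable]: "v \<in> borel_measurable borel" "f \<in> borel_measurable borel"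
    using v f by (auto simp: square_integrable_def dest: borel_measurable_integrable)
  show "integrable lborel (\<lambda>x. norm (v x) + B * (norm (f x))\<^sup>2)"
    using f v by (auto simp: square_integrable_def)
  show "(\<lambda>x. f x * v x) \<in> borel_measurable lborel" by simp
  show "AE x in lborel. norm (f x * v x) \<le> norm (norm (v x) + B * (norm (f x))\<^sup>2)"
  proof (intro AE_I2)
    fix x
    have B0: "0 \<le> B" using B[of x] norm_ge_zero order_trans by blast
    have "norm (f x) \<le> 1 + (norm (f x))\<^sup>2" by (rule norm_le_one_plus_power2)
    then have "norm (f x * v x) \<le> (1 + (norm (f x))\<^sup>2) * norm (v x)"
      unfolding norm_mult by (rule mult_right_mono) simp
    also have "\<dots> \<le> norm (v x) + B * (norm (f x))\<^sup>2"
      using mult_right_mono[OF B[of x], of "(norm (f x))\<^sup>2"] by (simp add: algebra_simps)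
    finally show "norm (f x * v x) \<le> norm (norm (v x) + B * (norm (f x))\<^sup>2)" by simp
  qed
qed

text \<open>The truncated integrals that define the L2 transform are honest Fourier integrals of integrable
functions.\<close>
lemma square_integrable_truncate:
  fixes f :: "real \<Rightarrow> complex"
  assumes f: "square_integrable f"
  shows "integrable lborel (\<lambda>x. indicator {-R..R} x *\<^sub>R f x)"
proof -
  have "integrable lborel (\<lambda>x. f x * complex_of_real (indicator {-R..R} x))"
  proof (rule square_integrable_times_integrable[OF f, where B = 1])
    have "integrable lborel (indicator {-R..R} :: real \<Rightarrow> real)" by (rule integrable_real_indicator) (auto simp: emeasure_lborel_Icc_eq)
    then show "integrable lborel (\<lambda>x. complex_of_real (indicator {-R..R} x))" by (rule integrable_of_real)
  qed (auto simp: indicator_def)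
  moreover have "f x * complex_of_real (indicator {-R..R} x) = indicator {-R..R} x *\<^sub>R f x" for x
    by (simp add: indicator_def)
  ultimately show ?thesis by simp
qed

lemma fourier_truncate_norm_le:
  fixes f :: "real \<Rightarrow> complex"
  assumes f: "square_integrable f"
  shows "(\<integral>\<^sup>+\<omega>. ennreal ((norm (fourier_integral R f \<omega>))\<^sup>2) \<partial>lborel) \<le> ennreal (2 * pi * (LINT x|lborel. (norm (f x))\<^sup>2))"
proof -
  have "(\<integral>\<^sup>+\<omega>. ennreal ((norm (fourier_integral R f \<omega>))\<^sup>2) \<partial>lborel) \<le>
     ennreal (2 * pi) * (\<integral>\<^sup>+x. ennreal ((norm (indicator {-R..R} x *\<^sub>R f x))\<^sup>2) \<partial>lborel)"
    unfolding fourier_integral_eq_fourier by (rule fourier_norm_le[OF square_integrable_truncate[OF f]])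
  also have "\<dots> \<le> ennreal (2 * pi) * (\<integral>\<^sup>+x. ennreal ((norm (f x))\<^sup>2) \<partial>lborel)"
    by (intro mult_left_mono nn_integral_mono) (auto simp: indicator_def)
  also have "(\<integral>\<^sup>+x. ennreal ((norm (f x))\<^sup>2) \<partial>lborel) = ennreal (LINT x|lborel. (norm (f x))\<^sup>2)"
    using f by (intro nn_integral_eq_integral) (auto simp: square_integrable_def)
  finally show ?thesis by (simp add: ennreal_mult)
qed

lemma L2_fourier_sequence:
  assumes "has_L2_fourier_transform f g"
  shows "(\<lambda>n. \<integral>\<^sup>+\<omega>. ennreal ((norm (g \<omega> - fourier_integral (real n) f \<omega>))\<^sup>2) \<partial>lborel) \<longlonglongrightarrow> 0"
  using assms unfolding has_L2_fourier_transform_def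
  by (auto intro: filterlim_compose[OF _ filterlim_real_sequentially])

lemma fourier_integral_measurable:
  assumes "square_integrable f"
  shows "fourier_integral R f \<in> borel_measurable borel"
  using assms unfolding fourier_integral_eq_fourier
  by (intro fourier_measurable) (auto simp: square_integrable_def)

text \<open>The bound holds uniformly for the truncated functions and passes to the L2 limit. The weighted
inequality with \<open>t\<close> fixed makes the error term vanish first, and \<open>t\<close> tends to 0 afterwards.\<close>
lemma L2_fourier_norm_le:
  assumes fg: "has_L2_fourier_transform f g"
  shows "(LINT \<omega>|lborel. (norm (g \<omega>))\<^sup>2) \<le> 2 * pi * (LINT x|lborel. (norm (f x))\<^sup>2)"
proof -
  let ?N = "2 * pi * (LINT x|lborel. (norm (f x))\<^sup>2)"
  let ?d = "\<lambda>n. \<integral>\<^sup>+\<omega>. ennreal ((norm (g \<omega> - fourier_integral (real n) f \<omega>))\<^sup>2) \<partial>lborel"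
  have f: "square_integrable f" and g: "square_integrable g"
    using fg by (auto simp: has_L2_fourier_transform_def)
  have [measurable]: "g \<in> borel_measurable borel" "\<And>R. fourier_integral R f \<in> borel_measurable borel"
    using g fourier_integral_measurable[OF f] by (auto simp: square_integrable_def)
  have N0: "0 \<le> ?N" by simp
  have le: "(LINT \<omega>|lborel. (norm (g \<omega>))\<^sup>2) \<le> (1 + t) * ?N" if t: "0 < t" for t
  proof -
    have "ennreal (LINT \<omega>|lborel. (norm (g \<omega>))\<^sup>2) \<le> ennreal ((1 + t) * ?N) + ennreal (1 + 1 / t) * ?d n" for n
    proof -
      have "ennreal (LINT \<omega>|lborel. (norm (g \<omega>))\<^sup>2) = (\<integral>\<^sup>+\<omega>. ennreal ((norm (g \<omega>))\<^sup>2) \<partial>lborel)"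
        using g by (intro nn_integral_eq_integral[symmetric]) (auto simp: square_integrable_def)
      also have "\<dots> \<le> (\<integral>\<^sup>+\<omega>. ennreal (1 + t) * ennreal ((norm (fourier_integral (real n) f \<omega>))\<^sup>2) +
          ennreal (1 + 1 / t) * ennreal ((norm (g \<omega> - fourier_integral (real n) f \<omega>))\<^sup>2) \<partial>lborel)"
        using t norm_power2_le_weighted[OF t]
        by (intro nn_integral_mono) (simp add: ennreal_mult[symmetric] ennreal_plus[symmetric] del: ennreal_plus)
      also have "\<dots> = ennreal (1 + t) * (\<integral>\<^sup>+\<omega>. ennreal ((norm (fourier_integral (real n) f \<omega>))\<^sup>2) \<partial>lborel) + ennreal (1 + 1 / t) * ?d n"
        by (simp add: nn_integral_add nn_integral_cmult)
      also have "\<dots> \<le> ennreal (1 + t) * ennreal ?N + ennreal (1 + 1 / t) * ?d n"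
        by (intro add_right_mono mult_left_mono fourier_truncate_norm_le[OF f]) auto
      also have "ennreal (1 + t) * ennreal ?N = ennreal ((1 + t) * ?N)"
        using t by (intro ennreal_mult[symmetric]) auto
      finally show ?thesis .
    qed
    moreover have "(\<lambda>n. ennreal ((1 + t) * ?N) + ennreal (1 + 1 / t) * ?d n) \<longlonglongrightarrow> ennreal ((1 + t) * ?N) + ennreal (1 + 1 / t) * 0"
      by (intro tendsto_add tendsto_const ennreal_tendsto_cmult L2_fourier_sequence[OF fg]) auto
    ultimately have "ennreal (LINT \<omega>|lborel. (norm (g \<omega>))\<^sup>2) \<le> ennreal ((1 + t) * ?N)"
      by (intro LIMSEQ_le_const) auto
    then show ?thesis using t by (simp add: ennreal_le_iff)
  qed
  show ?thesis
    using le_power2_sum_if_le_weighted[of "sqrt ?N" 0 "LINT \<omega>|lborel. (norm (g \<omega>))\<^sup>2"] le N0 by simp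
qed

text \<open>For each \<open>c > 0\<close> the pointwise bound \<open>\<bar>z v\<bar> \<le> c \<bar>v\<bar> + \<bar>z\<bar>\<^sup>2 / c\<close> holds, as is seen by comparing
\<open>\<bar>z\<bar>\<close> with \<open>c\<close>. Choosing \<open>c\<close> small and then the index large makes both integrals small.\<close>
lemma L2_null_imp_weak_null:
  fixes z :: "nat \<Rightarrow> real \<Rightarrow> complex"
  assumes [measurable]: "\<And>n. z n \<in> borel_measurable borel"
    and lim: "(\<lambda>n. \<integral>\<^sup>+\<omega>. ennreal ((norm (z n \<omega>))\<^sup>2) \<partial>lborel) \<longlonglongrightarrow> 0"
    and v: "integrable lborel v" and v1: "\<And>\<omega>. norm (v \<omega>) \<le> (1::real)"
  shows "(\<lambda>n. LINT \<omega>|lborel. z n \<omega> * v \<omega>) \<longlonglongrightarrow> 0"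
proof (rule tendstoI)
  fix e :: real assume e: "0 < e"
  have [measurable]: "v \<in> borel_measurable borel" using v by (auto dest: borel_measurable_integrable)
  define C where "C = (LINT \<omega>|lborel. norm (v \<omega>))"
  have C0: "0 \<le> C" by (simp add: C_def)
  define c where "c = e / (2 * (C + 1))"
  have c: "0 < c" using e C0 by (simp add: c_def)
  have "eventually (\<lambda>n. (\<integral>\<^sup>+\<omega>. ennreal ((norm (z n \<omega>))\<^sup>2) \<partial>lborel) < ennreal (c * (e / 2))) sequentially"
    using lim c e by (intro order_tendstoD(2)[OF lim]) auto
  then show "eventually (\<lambda>n. dist (LINT \<omega>|lborel. z n \<omega> * v \<omega>) 0 < e) sequentially"
  proof eventually_elim
    case (elim n)
    have pw: "norm (z n \<omega> * v \<omega>) \<le> c * norm (v \<omega>) + (1 / c) * (norm (z n \<omega>))\<^sup>2" for \<omega>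
    proof (cases "norm (z n \<omega>) \<le> c")
      case True
      then have "norm (z n \<omega> * v \<omega>) \<le> c * norm (v \<omega>)" by (simp add: norm_mult mult_right_mono)
      then show ?thesis using c by (smt (verit) zero_le_divide_iff mult_nonneg_nonneg zero_le_power2)
    next
      case False
      have "norm (z n \<omega> * v \<omega>) \<le> norm (z n \<omega>) * 1" unfolding norm_mult by (intro mult_left_mono v1) simp
      also have "\<dots> \<le> (1 / c) * (norm (z n \<omega>))\<^sup>2"
        using False c mult_right_mono[of c "norm (z n \<omega>)" "norm (z n \<omega>)"] by (simp add: field_simps power2_eq_square)
      finally show ?thesis using c by (smt (verit) mult_nonneg_nonneg norm_ge_zero)
    qed
    have "ennreal (norm (LINT \<omega>|lborel. z n \<omega> * v \<omega>)) \<le> (\<integral>\<^sup>+\<omega>. ennreal (norm (z n \<omega> * v \<omega>)) \<partial>lborel)"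
      by (cases "integrable lborel (\<lambda>\<omega>. z n \<omega> * v \<omega>)") (auto simp: integral_norm_bound_ennreal not_integrable_integral_eq)
    also have "\<dots> \<le> (\<integral>\<^sup>+\<omega>. ennreal c * ennreal (norm (v \<omega>)) + ennreal (1 / c) * ennreal ((norm (z n \<omega>))\<^sup>2) \<partial>lborel)"
      using c pw by (intro nn_integral_mono) (simp add: ennreal_mult[symmetric] ennreal_plus[symmetric] del: ennreal_plus)
    also have "\<dots> = ennreal c * (\<integral>\<^sup>+\<omega>. ennreal (norm (v \<omega>)) \<partial>lborel) + ennreal (1 / c) * (\<integral>\<^sup>+\<omega>. ennreal ((norm (z n \<omega>))\<^sup>2) \<partial>lborel)"
      by (simp add: nn_integral_add nn_integral_cmult)
    also have "(\<integral>\<^sup>+\<omega>. ennreal (norm (v \<omega>)) \<partial>lborel) = ennreal C"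
      unfolding C_def using v by (intro nn_integral_eq_integral) auto
    also have "ennreal c * ennreal C + ennreal (1 / c) * (\<integral>\<^sup>+\<omega>. ennreal ((norm (z n \<omega>))\<^sup>2) \<partial>lborel)
        \<le> ennreal c * ennreal C + ennreal (1 / c) * ennreal (c * (e / 2))"
      using elim by (intro add_left_mono mult_left_mono) auto
    also have "\<dots> = ennreal (c * C + e / 2)"
      using c e C0 by (simp add: ennreal_mult[symmetric] ennreal_plus[symmetric] del: ennreal_plus)
    finally have "norm (LINT \<omega>|lborel. z n \<omega> * v \<omega>) \<le> c * C + e / 2"
      using c e C0 by (subst (asm) ennreal_le_iff) auto
    also have "c * C < e / 2" using e C0 by (simp add: c_def field_simps)
    finally show ?case by simp
  qed
qed

text \<open>The formula holds for the truncations of \<open>f\<close>. On the frequency side the L2 convergence of their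
transforms suffices, because \<open>damp k\<close> is bounded and integrable; on the space side, dominated
convergence.\<close>
lemma L2_fourier_gaussian_summation:
  assumes fg: "has_L2_fourier_transform f g" and k: "0 < k"
  shows "(LINT \<omega>|lborel. g \<omega> * (complex_of_real (damp k \<omega>) * cis (\<omega> * a))) =
    2 * pi * (LINT x|lborel. f x * complex_of_real (gauss_kernel k (x - a)))"
proof -
  have f: "square_integrable f" and g: "square_integrable g"
    using fg by (auto simp: has_L2_fourier_transform_def)
  have fm: "\<And>R. fourier_integral R f \<in> borel_measurable borel" and [measurable]: "g \<in> borel_measurable borel" "f \<in> borel_measurable borel"
    using f g fourier_integral_measurable[OF f] by (auto simp: square_integrable_def)
  let ?v = "\<lambda>\<omega>. complex_of_real (damp k \<omega>) * cis (\<omega> * a)"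
  let ?K = "\<lambda>x. complex_of_real (gauss_kernel k (x - a))"
  let ?f = "\<lambda>n x. indicator {-real n..real n} x *\<^sub>R f x"
  have v: "integrable lborel ?v" by (rule damped_cis_integrable[OF k])
  have v1: "norm (?v \<omega>) \<le> 1" for \<omega>
    using damp_bounds[of k \<omega>] by (simp add: norm_mult)
  have lim1: "(\<lambda>n. LINT \<omega>|lborel. (g \<omega> - fourier_integral (real n) f \<omega>) * ?v \<omega>) \<longlonglongrightarrow> 0"
    using fm by (intro L2_null_imp_weak_null[OF _ L2_fourier_sequence[OF fg] v v1]) auto
  have fn: "integrable lborel (\<lambda>\<omega>. fourier_integral (real n) f \<omega> * ?v \<omega>)" for n
  proof -
    have "integrable lborel (\<lambda>\<omega>. ?v \<omega> * fourier_integral (real n) f \<omega>)"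
      using norm_fourier_le[of "?f n"] fm[of "real n"]
      by (intro integrable_times_bounded[OF v, where B = "LINT x|lborel. norm (?f n x)"])
        (auto simp: fourier_integral_eq_fourier simp del: norm_scaleR)
    then show ?thesis by (simp add: mult.commute)
  qed
  have gv: "integrable lborel (\<lambda>\<omega>. g \<omega> * ?v \<omega>)"
    by (rule square_integrable_times_integrable[OF g v v1])
  have K: "integrable lborel ?K"
    using gauss_kernel_integral(1)[OF k] by simp
  have fK: "integrable lborel (\<lambda>x. f x * ?K x)"
    using k by (intro square_integrable_times_integrable[OF f K, where B = k]) (auto simp: gauss_kernel_le gauss_kernel_nonneg)
  have "(\<lambda>n. LINT x|lborel. ?f n x * ?K x) \<longlonglongrightarrow> (LINT x|lborel. f x * ?K x)"
  proof (rule integral_dominated_convergence[where w = "\<lambda>x. norm (f x * ?K x)"])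
    show "AE x in lborel. (\<lambda>n. ?f n x * ?K x) \<longlonglongrightarrow> f x * ?K x"
    proof (intro AE_I2 tendsto_eventually)
      fix x :: real
      obtain N where "\<bar>x\<bar> \<le> real N" using real_arch_simple by blast
      then show "eventually (\<lambda>n. ?f n x * ?K x = f x * ?K x) sequentially"
        by (intro eventually_sequentiallyI[of N]) (auto simp: indicator_def)
    qed
    show "AE x in lborel. norm (?f n x * ?K x) \<le> norm (f x * ?K x)" for n
      by (auto simp: indicator_def)
  qed (use fK in auto)
  then have lim2: "(\<lambda>n. 2 * pi * (LINT x|lborel. ?f n x * ?K x)) \<longlonglongrightarrow> 2 * pi * (LINT x|lborel. f x * ?K x)"
    by (intro tendsto_intros)
  have "(LINT \<omega>|lborel. (g \<omega> - fourier_integral (real n) f \<omega>) * ?v \<omega>) + 2 * pi * (LINT x|lborel. ?f n x * ?K x)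
      = (LINT \<omega>|lborel. g \<omega> * ?v \<omega>)" for n
  proof -
    have "(LINT \<omega>|lborel. (g \<omega> - fourier_integral (real n) f \<omega>) * ?v \<omega>) =
        (LINT \<omega>|lborel. g \<omega> * ?v \<omega>) - (LINT \<omega>|lborel. fourier_integral (real n) f \<omega> * ?v \<omega>)"
      by (subst Bochner_Integration.integral_diff[OF gv fn, symmetric]) (simp add: left_diff_distrib)
    also have "(LINT \<omega>|lborel. fourier_integral (real n) f \<omega> * ?v \<omega>) = 2 * pi * (LINT x|lborel. ?f n x * ?K x)"
      unfolding fourier_integral_eq_fourier
      by (rule fourier_gaussian_summation[OF k square_integrable_truncate[OF f]])
    finally show ?thesis by simp
  qed
  then show ?thesis
    using tendsto_add[OF lim1 lim2] by (simp add: LIMSEQ_const_iff)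
qed

section \<open>Fourier inversion for continuous functions\<close>

text \<open>The scaled form has a fixed integrable weight, which suits dominated convergence.\<close>
lemma gauss_kernel_scaled:
  fixes F :: "real \<Rightarrow> complex"
  assumes k: "0 < k"
  shows "(LINT x|lborel. F x * complex_of_real (gauss_kernel k (x - a))) =
    (LINT y|lborel. F (a + y / k) * complex_of_real (std_normal_density y))"
proof -
  have "(LINT x|lborel. F x * complex_of_real (gauss_kernel k (x - a))) =
      \<bar>1 / k\<bar> *\<^sub>R (LINT y|lborel. F (a + (1 / k) * y) * complex_of_real (gauss_kernel k (a + (1 / k) * y - a)))"
    using k by (intro lborel_integral_real_affine) auto
  also have "\<dots> = (LINT y|lborel. \<bar>1 / k\<bar> *\<^sub>R (F (a + (1 / k) * y) * complex_of_real (gauss_kernel k (a + (1 / k) * y - a))))"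
    by (rule integral_scaleR_right[symmetric])
  also have "\<dots> = (LINT y|lborel. F (a + y / k) * complex_of_real (std_normal_density y))"
    using k by (intro Bochner_Integration.integral_cong) (auto simp: gauss_kernel_def scaleR_conv_of_real)
  finally show ?thesis .
qed

text \<open>The cut-off to a bounded interval makes \<open>f\<close> bounded, and in scaled form the integrand is dominated
by a multiple of the normal density.\<close>
lemma gauss_kernel_local_limit:
  fixes f :: "real \<Rightarrow> complex"
  assumes f: "continuous_on UNIV f"
  shows "(\<lambda>n. LINT x|lborel. (indicator {a - 1..a + 1} x * f x) * complex_of_real (gauss_kernel (real (Suc n)) (x - a))) \<longlonglongrightarrow> f a"
proof -
  let ?F = "\<lambda>x. indicator {a - 1..a + 1} x * f x"
  let ?k = "\<lambda>n. real (Suc n)"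
  have fm [measurable]: "f \<in> borel_measurable borel"
    by (rule borel_measurable_continuous_onI[OF f])
  have "bounded (f ` {a - 1..a + 1})"
    by (intro compact_imp_bounded compact_continuous_image continuous_on_subset[OF f]) auto
  then obtain B where "\<forall>y\<in>f ` {a - 1..a + 1}. norm y \<le> B" unfolding bounded_iff by blast
  then have B: "norm (f x) \<le> B" if "a - 1 \<le> x" "x \<le> a + 1" for x
    using that by auto
  have B0: "0 \<le> B" using order_trans[OF norm_ge_zero B[of a]] by simp
  have FB: "norm (?F x) \<le> B" for x
    using B[of x] B0 by (auto simp: indicator_def)
  have k0: "(\<lambda>n. y / ?k n) \<longlonglongrightarrow> 0" for y :: real
    by (intro tendsto_divide_0[OF tendsto_const] filterlim_at_top_imp_at_infinity
          filterlim_compose[OF filterlim_real_sequentially filterlim_Suc])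
  have "(\<lambda>n. LINT y|lborel. ?F (a + y / ?k n) * complex_of_real (std_normal_density y)) \<longlonglongrightarrow>
      (LINT y|lborel. f a * complex_of_real (std_normal_density y))"
  proof (rule integral_dominated_convergence[where w = "\<lambda>y. B * std_normal_density y"])
    show "AE y in lborel. (\<lambda>n. ?F (a + y / ?k n) * complex_of_real (std_normal_density y)) \<longlonglongrightarrow> f a * complex_of_real (std_normal_density y)"
    proof (intro AE_I2 tendsto_mult tendsto_const)
      fix y :: real
      have "isCont f a" using f by (simp add: continuous_on_eq_continuous_at)
      then have "(\<lambda>n. f (a + y / ?k n)) \<longlonglongrightarrow> f a"
        using isCont_tendsto_compose[of a f "\<lambda>n. a + y / ?k n" sequentially] tendsto_add[OF tendsto_const k0[of y], of a] by simp
      moreover have "eventually (\<lambda>n. \<bar>y / ?k n\<bar> < 1) sequentially"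
        using tendsto_rabs[OF k0[of y]] by (intro order_tendstoD) auto
      then have "eventually (\<lambda>n. f (a + y / ?k n) = ?F (a + y / ?k n)) sequentially"
      proof eventually_elim
        case (elim n)
        then have "a + y / ?k n \<in> {a - 1..a + 1}" unfolding abs_less_iff by (simp only: atLeastAtMost_iff) linarith
        then show ?case by (simp only: indicator_simps mult_1_left)
      qed
      ultimately show "(\<lambda>n. ?F (a + y / ?k n)) \<longlonglongrightarrow> f a"
        by (rule Lim_transform_eventually)
    qed
    show "AE y in lborel. norm (?F (a + y / ?k n) * complex_of_real (std_normal_density y)) \<le> B * std_normal_density y" for n
      using FB by (intro AE_I2) (simp add: norm_mult mult_right_mono del: norm_of_real, simp add: mult_right_mono)
  qed auto
  moreover have "(LINT y|lborel. f a * complex_of_real (std_normal_density y)) = f a"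
    by (subst integral_mult_right_zero) (simp add: integral_complex_of_real)
  ultimately show ?thesis
    by (subst gauss_kernel_scaled) simp_all
qed

lemma gauss_kernel_far_null: "(\<lambda>n. gauss_kernel (real (Suc n)) 1) \<longlonglongrightarrow> 0"
proof (rule Lim_null_comparison)
  have "(\<lambda>n. 2 * inverse (real (Suc n))) \<longlonglongrightarrow> 2 * 0"
    by (intro tendsto_intros LIMSEQ_inverse_real_of_nat)
  then show "(\<lambda>n. 2 * inverse (real (Suc n))) \<longlonglongrightarrow> 0" by simp
  show "eventually (\<lambda>n. norm (gauss_kernel (real (Suc n)) 1) \<le> 2 * inverse (real (Suc n))) sequentially"
  proof (intro always_eventually allI)
    fix n
    define k where "k = real (Suc n)"
    have k: "0 < k" by (simp add: k_def)
    have s: "1 \<le> sqrt (2 * pi)" using pi_ge_two by simp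
    have "k\<^sup>2 / 2 \<le> exp (k\<^sup>2 / 2)" using exp_ge_add_one_self[of "k\<^sup>2 / 2"] by linarith
    then have "k * exp (- k\<^sup>2 / 2) \<le> 2 * inverse k"
      using k by (simp add: exp_minus field_simps power2_eq_square)
    moreover have "gauss_kernel k 1 = (1 / sqrt (2 * pi)) * (k * exp (- k\<^sup>2 / 2))"
      by (simp add: gauss_kernel_def normal_density_def)
    moreover have "(1 / sqrt (2 * pi)) * (k * exp (- k\<^sup>2 / 2)) \<le> 1 * (k * exp (- k\<^sup>2 / 2))"
      using s k by (intro mult_right_mono) auto
    ultimately show "norm (gauss_kernel (real (Suc n)) 1) \<le> 2 * inverse (real (Suc n))"
      using gauss_kernel_nonneg[of k 1] k unfolding k_def[symmetric] by simp
  qed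
qed

lemma gauss_kernel_antimono:
  assumes "0 < k" "\<bar>y\<bar> \<le> \<bar>z\<bar>"
  shows "gauss_kernel k z \<le> gauss_kernel k y"
proof -
  have "(k * y)\<^sup>2 \<le> (k * z)\<^sup>2" using assms by (simp add: abs_le_square_iff[symmetric] abs_mult)
  then show ?thesis using assms unfolding gauss_kernel_def normal_density_def
    by (intro mult_left_mono) auto
qed

text \<open>Near \<open>a\<close> the local limit applies. Away from \<open>a\<close>, \<open>\<bar>f\<bar> \<le> 1 + \<bar>f\<bar>\<^sup>2\<close> splits the remainder into the
tail mass of the kernel, which vanishes by the local limit for the constant 1, and the squared norm of
\<open>f\<close> times the value of the kernel at distance 1.\<close>
lemma gauss_kernel_limit:
  fixes f :: "real \<Rightarrow> complex"
  assumes f: "continuous_on UNIV f" and f2: "square_integrable f"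
  shows "(\<lambda>n. LINT x|lborel. f x * complex_of_real (gauss_kernel (real (Suc n)) (x - a))) \<longlonglongrightarrow> f a"
proof -
  let ?I = "{a - 1..a + 1}"
  let ?k = "\<lambda>n. real (Suc n)"
  let ?K = "\<lambda>n x. complex_of_real (gauss_kernel (?k n) (x - a))"
  let ?N = "LINT x|lborel. (norm (f x))\<^sup>2"
  have [measurable]: "f \<in> borel_measurable borel" using f2 by (simp add: square_integrable_def)
  have K: "integrable lborel (?K n)" for n
    using gauss_kernel_integral(1)[of "?k n"] by (intro integrable_of_real) simp
  have fK: "integrable lborel (\<lambda>x. f x * ?K n x)" for n
    by (intro square_integrable_times_integrable[OF f2 K, where B = "?k n"]) (auto simp: gauss_kernel_le gauss_kernel_nonneg)
  have near: "integrable lborel (\<lambda>x. (indicator ?I x * f x) * ?K n x)" for n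
    using fK[of n] by (rule Bochner_Integration.integrable_bound) (auto simp: indicator_def)
  have Knear: "integrable lborel (\<lambda>x. (indicator ?I x * 1) * ?K n x)" for n
    using K[of n] by (rule Bochner_Integration.integrable_bound) (auto simp: indicator_def)
  define R where "R n = norm (1 - (LINT x|lborel. (indicator ?I x * 1) * ?K n x)) + gauss_kernel (?k n) 1 * ?N" for n
  have "(\<lambda>n. LINT x|lborel. (indicator ?I x * 1) * ?K n x) \<longlonglongrightarrow> 1"
    by (rule gauss_kernel_local_limit[where f = "\<lambda>_. 1"]) simp
  then have "R \<longlonglongrightarrow> norm (1 - 1 :: complex) + 0 * ?N"
    unfolding R_def by (intro tendsto_intros gauss_kernel_far_null)
  then have R: "R \<longlonglongrightarrow> 0" by simp
  have le: "norm ((LINT x|lborel. f x * ?K n x) - (LINT x|lborel. (indicator ?I x * f x) * ?K n x)) \<le> R n" for n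
  proof -
    let ?J = "\<lambda>x. indicator (- ?I) x * gauss_kernel (?k n) (x - a)"
    have J: "integrable lborel ?J"
      using integrable_mult_indicator[OF _ gauss_kernel_integral(1)[of "?k n" a], of "- ?I"] by simp
    have diff: "(LINT x|lborel. f x * ?K n x) - (LINT x|lborel. (indicator ?I x * f x) * ?K n x) =
        (LINT x|lborel. f x * ?K n x - (indicator ?I x * f x) * ?K n x)"
      by (rule Bochner_Integration.integral_diff[OF fK near, symmetric])
    have "norm ((LINT x|lborel. f x * ?K n x) - (LINT x|lborel. (indicator ?I x * f x) * ?K n x))
        \<le> (LINT x|lborel. ?J x + gauss_kernel (?k n) 1 * (norm (f x))\<^sup>2)"
      unfolding diff
    proof (rule Bochner_Integration.integral_norm_bound_integral)
      show "integrable lborel (\<lambda>x. f x * ?K n x - (indicator ?I x * f x) * ?K n x)" using fK near by simp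
      show "integrable lborel (\<lambda>x. ?J x + gauss_kernel (?k n) 1 * (norm (f x))\<^sup>2)"
        using J f2 by (simp add: square_integrable_def)
      fix x
      show "norm (f x * ?K n x - (indicator ?I x * f x) * ?K n x) \<le> ?J x + gauss_kernel (?k n) 1 * (norm (f x))\<^sup>2"
      proof (cases "x \<in> ?I")
        case True
        then show ?thesis by (simp add: gauss_kernel_nonneg)
      next
        case False
        have "gauss_kernel (?k n) (x - a) \<le> gauss_kernel (?k n) 1"
          using False by (intro gauss_kernel_antimono) auto
        moreover have "norm (f x) \<le> 1 + (norm (f x))\<^sup>2" by (rule norm_le_one_plus_power2)
        then have "norm (f x) * gauss_kernel (?k n) (x - a) \<le> (1 + (norm (f x))\<^sup>2) * gauss_kernel (?k n) (x - a)"
          by (intro mult_right_mono gauss_kernel_nonneg) auto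
        moreover have "(norm (f x))\<^sup>2 * gauss_kernel (?k n) (x - a) \<le> (norm (f x))\<^sup>2 * gauss_kernel (?k n) 1"
          using calculation(1) by (intro mult_left_mono) auto
        ultimately have "norm (f x) * gauss_kernel (?k n) (x - a) \<le> gauss_kernel (?k n) (x - a) + gauss_kernel (?k n) 1 * (norm (f x))\<^sup>2"
          unfolding distrib_right mult_1_left mult.commute[of "(norm (f x))\<^sup>2"] by linarith
        then show ?thesis using False by (simp add: norm_mult gauss_kernel_nonneg)
      qed
    qed
    also have "(LINT x|lborel. ?J x + gauss_kernel (?k n) 1 * (norm (f x))\<^sup>2) = (LINT x|lborel. ?J x) + gauss_kernel (?k n) 1 * ?N"
      using J f2 by (subst Bochner_Integration.integral_add) (auto simp: square_integrable_def)
    also have "(LINT x|lborel. ?J x) \<le> norm (1 - (LINT x|lborel. (indicator ?I x * 1) * ?K n x))"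
    proof -
      have "complex_of_real (LINT x|lborel. ?J x) = (LINT x|lborel. ?K n x - (indicator ?I x * 1) * ?K n x)"
        by (subst integral_complex_of_real[symmetric]) (auto intro!: Bochner_Integration.integral_cong simp: indicator_def)
      also have "\<dots> = (LINT x|lborel. ?K n x) - (LINT x|lborel. (indicator ?I x * 1) * ?K n x)"
        by (rule Bochner_Integration.integral_diff[OF K Knear])
      also have "(LINT x|lborel. ?K n x) = 1"
        using gauss_kernel_integral(2)[of "?k n" a] by (simp add: integral_complex_of_real)
      finally have "norm (complex_of_real (LINT x|lborel. ?J x)) = norm (1 - (LINT x|lborel. (indicator ?I x * 1) * ?K n x))" by simp
      then show ?thesis by simp
    qed
    finally show ?thesis by (simp add: R_def)
  qed
  have "(\<lambda>n. (LINT x|lborel. f x * ?K n x) - (LINT x|lborel. (indicator ?I x * f x) * ?K n x)) \<longlonglongrightarrow> 0"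
    using le by (intro Lim_null_comparison[OF _ R]) auto
  from tendsto_add[OF this gauss_kernel_local_limit[OF f, of a]] show ?thesis by simp
qed

text \<open>Both sides are limits of the same Gaussian means: on the frequency side because the damping tends to
1, on the space side because the kernel is an approximate identity at a point of continuity.\<close>
lemma L2_fourier_inversion:
  assumes fg: "has_L2_fourier_transform f g" and g: "integrable lborel g" and f: "continuous_on UNIV f"
  shows "f a = (1 / (2 * pi)) * (LINT \<omega>|lborel. g \<omega> * cis (\<omega> * a))"
proof -
  have [measurable]: "g \<in> borel_measurable borel" using g by (auto dest: borel_measurable_integrable)
  have "(\<lambda>n. LINT \<omega>|lborel. g \<omega> * (complex_of_real (damp (real (Suc n)) \<omega>) * cis (\<omega> * a))) \<longlonglongrightarrow>
      (LINT \<omega>|lborel. g \<omega> * cis (\<omega> * a))"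
  proof (rule integral_dominated_convergence[where w = "\<lambda>\<omega>. norm (g \<omega>)"])
    show "AE \<omega> in lborel. (\<lambda>n. g \<omega> * (complex_of_real (damp (real (Suc n)) \<omega>) * cis (\<omega> * a))) \<longlonglongrightarrow> g \<omega> * cis (\<omega> * a)"
    proof (intro AE_I2)
      fix \<omega>
      have "(\<lambda>n. g \<omega> * (complex_of_real (damp (real (Suc n)) \<omega>) * cis (\<omega> * a))) \<longlonglongrightarrow> g \<omega> * (complex_of_real 1 * cis (\<omega> * a))"
        by (intro tendsto_intros damp_limit)
      then show "(\<lambda>n. g \<omega> * (complex_of_real (damp (real (Suc n)) \<omega>) * cis (\<omega> * a))) \<longlonglongrightarrow> g \<omega> * cis (\<omega> * a)" by simp
    qed
    show "AE \<omega> in lborel. norm (g \<omega> * (complex_of_real (damp (real (Suc n)) \<omega>) * cis (\<omega> * a))) \<le> norm (g \<omega>)" for n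
      using damp_bounds[of "real (Suc n)"] by (intro AE_I2) (simp add: norm_mult mult_left_le abs_of_pos del: of_nat_Suc)
  qed (use g in auto)
  moreover have "(\<lambda>n. LINT \<omega>|lborel. g \<omega> * (complex_of_real (damp (real (Suc n)) \<omega>) * cis (\<omega> * a))) \<longlonglongrightarrow> 2 * pi * f a"
    using fg unfolding L2_fourier_gaussian_summation[OF fg of_nat_0_less_iff[THEN iffD2, OF zero_less_Suc]]
    by (intro tendsto_intros gauss_kernel_limit[OF f]) (simp add: has_L2_fourier_transform_def)
  ultimately have "(LINT \<omega>|lborel. g \<omega> * cis (\<omega> * a)) = 2 * pi * f a" by (rule LIMSEQ_unique)
  then show ?thesis by simp
qed

section \<open>Bernstein's inequality\<close>

text \<open>The second order Taylor bound \<open>\<bar>cis x - 1 - \<i> x\<bar> \<le> x\<^sup>2 / 2\<close> gives an error of order \<open>(b - a)\<^sup>2\<close> with the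
second moment of \<open>u\<close> as its constant.\<close>
lemma has_vector_derivative_fourier_synthesis:
  fixes u :: "real \<Rightarrow> complex"
  assumes u: "integrable lborel u" and u1: "integrable lborel (\<lambda>\<omega>. \<i> * \<omega> * u \<omega>)"
    and u2: "integrable lborel (\<lambda>\<omega>. \<omega>\<^sup>2 * norm (u \<omega>))"
  shows "((\<lambda>a. LINT \<omega>|lborel. u \<omega> * cis (\<omega> * a)) has_vector_derivative
    (LINT \<omega>|lborel. \<i> * \<omega> * u \<omega> * cis (\<omega> * a))) (at a)"
proof -
  let ?G = "\<lambda>a. LINT \<omega>|lborel. u \<omega> * cis (\<omega> * a)"
  let ?D = "LINT \<omega>|lborel. \<i> * \<omega> * u \<omega> * cis (\<omega> * a)"
  let ?C = "LINT \<omega>|lborel. \<omega>\<^sup>2 * norm (u \<omega>)"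
  have [measurable]: "u \<in> borel_measurable borel" using u by (auto dest: borel_measurable_integrable)
  have i1: "integrable lborel (\<lambda>\<omega>. u \<omega> * cis (\<omega> * b))" for b
    by (intro integrable_times_bounded[OF u, where B = 1]) auto
  have i2: "integrable lborel (\<lambda>\<omega>. \<i> * \<omega> * u \<omega> * cis (\<omega> * b))" for b
    by (intro integrable_times_bounded[OF u1, where B = 1]) auto
  have bound: "norm (?G b - ?G a - (b - a) *\<^sub>R ?D) \<le> (b - a)\<^sup>2 / 2 * ?C" for b
  proof -
    have "?G b - ?G a - (b - a) *\<^sub>R ?D =
        (LINT \<omega>|lborel. u \<omega> * cis (\<omega> * b) - u \<omega> * cis (\<omega> * a) - (b - a) *\<^sub>R (\<i> * \<omega> * u \<omega> * cis (\<omega> * a)))"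
      using i1 i2 by simp
    also have "norm \<dots> \<le> (LINT \<omega>|lborel. (b - a)\<^sup>2 / 2 * (\<omega>\<^sup>2 * norm (u \<omega>)))"
    proof (rule Bochner_Integration.integral_norm_bound_integral)
      show "integrable lborel (\<lambda>\<omega>. u \<omega> * cis (\<omega> * b) - u \<omega> * cis (\<omega> * a) - (b - a) *\<^sub>R (\<i> * \<omega> * u \<omega> * cis (\<omega> * a)))"
        using i1 i2 by simp
      show "integrable lborel (\<lambda>\<omega>. (b - a)\<^sup>2 / 2 * (\<omega>\<^sup>2 * norm (u \<omega>)))"
        using u2 by (rule integrable_mult_right)
      fix \<omega> :: real
      let ?x = "\<omega> * (b - a)"
      have "cis (\<omega> * b) = cis (\<omega> * a) * cis ?x" by (simp add: cis_mult algebra_simps)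
      then have "u \<omega> * cis (\<omega> * b) - u \<omega> * cis (\<omega> * a) - (b - a) *\<^sub>R (\<i> * \<omega> * u \<omega> * cis (\<omega> * a)) =
          u \<omega> * cis (\<omega> * a) * (cis ?x - (1 + \<i> * ?x))"
        by (simp add: algebra_simps scaleR_conv_of_real)
      moreover have "norm (cis ?x - (1 + \<i> * ?x)) \<le> \<bar>?x\<bar>\<^sup>2 / 2"
        using iexp_approx1[of ?x 1] by (simp add: cis_conv_exp numeral_2_eq_2)
      ultimately show "norm (u \<omega> * cis (\<omega> * b) - u \<omega> * cis (\<omega> * a) - (b - a) *\<^sub>R (\<i> * \<omega> * u \<omega> * cis (\<omega> * a)))
          \<le> (b - a)\<^sup>2 / 2 * (\<omega>\<^sup>2 * norm (u \<omega>))"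
        using mult_left_mono[of "norm (cis ?x - (1 + \<i> * ?x))" "\<bar>?x\<bar>\<^sup>2 / 2" "norm (u \<omega>)"]
        by (simp add: norm_mult power_mult_distrib mult_ac)
    qed
    also have "\<dots> = (b - a)\<^sup>2 / 2 * ?C" by (rule integral_mult_right_zero)
    finally show ?thesis .
  qed
  show ?thesis
    unfolding has_vector_derivative_def
  proof (rule has_derivativeI_sandwich[where e = 1 and H = "\<lambda>b. \<bar>b - a\<bar> / 2 * ?C"])
    show "bounded_linear (\<lambda>x. x *\<^sub>R ?D)" by (rule bounded_linear_scaleR_left)
    have "((\<lambda>b. \<bar>b - a\<bar> / 2 * ?C) \<longlongrightarrow> \<bar>a - a\<bar> / 2 * ?C) (at a)" by (intro tendsto_intros) simp
    then show "((\<lambda>b. \<bar>b - a\<bar> / 2 * ?C) \<longlongrightarrow> 0) (at a within UNIV)" by simp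
    fix b assume "b \<noteq> a"
    have "norm (?G b - ?G a - (b - a) *\<^sub>R ?D) / norm (b - a) \<le> ((b - a)\<^sup>2 / 2 * ?C) / norm (b - a)"
      by (intro divide_right_mono bound) simp
    also have "((b - a)\<^sup>2 / 2 * ?C) / norm (b - a) = \<bar>b - a\<bar> / 2 * ?C"
    proof -
      define d where "d = \<bar>b - a\<bar>"
      have "(b - a)\<^sup>2 = d * d" "d \<noteq> 0" using \<open>b \<noteq> a\<close> by (simp_all add: d_def power2_eq_square)
      then show ?thesis unfolding real_norm_def d_def[symmetric] by (simp only: field_simps) simp
    qed
    finally show "norm (?G b - ?G a - (b - a) *\<^sub>R ?D) / norm (b - a) \<le> \<bar>b - a\<bar> / 2 * ?C" .
  qed simp
qed

lemma has_L2_fourier_transform_cong_AE: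
  assumes fg: "has_L2_fourier_transform f g" and ae: "AE \<omega> in lborel. g \<omega> = g' \<omega>"
    and [measurable]: "g' \<in> borel_measurable borel"
  shows "has_L2_fourier_transform f g'"
proof -
  have [measurable]: "g \<in> borel_measurable borel"
    using fg by (simp add: has_L2_fourier_transform_def square_integrable_def)
  have "square_integrable g'"
    unfolding square_integrable_def
  proof
    show "integrable lborel (\<lambda>x. (norm (g' x))\<^sup>2)"
      using fg ae unfolding has_L2_fourier_transform_def square_integrable_def
      by (subst integrable_cong_AE[where g = "\<lambda>x. (norm (g x))\<^sup>2"]) auto
  qed simp
  moreover have "(\<integral>\<^sup>+\<omega>. ennreal ((norm (g' \<omega> - fourier_integral R f \<omega>))\<^sup>2) \<partial>lborel) =
      (\<integral>\<^sup>+\<omega>. ennreal ((norm (g \<omega> - fourier_integral R f \<omega>))\<^sup>2) \<partial>lborel)" for R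
    using ae by (intro nn_integral_cong_AE) auto
  ultimately show ?thesis using fg by (simp add: has_L2_fourier_transform_def)
qed

text \<open>The \<open>k\<close>-th derivative is the inverse Fourier integral of \<open>(\<i> \<omega>)\<^sup>k g \<omega>\<close>. Its squared norm is at most
\<open>1 / (2 \<pi>)\<close> times that of this function, hence at most \<open>m\<^sup>2\<^sup>k / (2 \<pi>)\<close> times that of \<open>g\<close>, and the
latter is at most \<open>2 \<pi>\<close> times that of \<open>f\<close>.\<close>
lemma bernstein_inequality:
  assumes fg: "has_L2_fourier_transform f g" and supp: "AE \<omega> in lborel. m < \<bar>\<omega>\<bar> \<longrightarrow> g \<omega> = 0"
    and m: "0 \<le> m"
    and D0: "D 0 = f" and D: "\<And>k x. (D k has_vector_derivative D (Suc k) x) (at x)"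
  shows "integrable lborel (\<lambda>x. (norm (D k x))\<^sup>2)"
    and "(LINT x|lborel. (norm (D k x))\<^sup>2) \<le> (m ^ k)\<^sup>2 * (LINT x|lborel. (norm (f x))\<^sup>2)"
proof -
  have gm [measurable]: "g \<in> borel_measurable borel"
    using fg by (simp add: has_L2_fourier_transform_def square_integrable_def)
  \<comment> \<open>Cutting off at \<open>m\<close> changes \<open>g\<close> on a null set only, and makes every \<open>u k\<close> integrable.\<close>
  define u where "u k \<omega> = (if \<bar>\<omega>\<bar> \<le> m then (\<i> * complex_of_real \<omega>) ^ k * g \<omega> else 0)" for k \<omega>
  have um [measurable]: "u k \<in> borel_measurable borel" for k
    unfolding u_def by measurable
  have fu: "has_L2_fourier_transform f (u 0)"
    using supp by (intro has_L2_fourier_transform_cong_AE[OF fg]) (auto simp: u_def)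
  have sq: "square_integrable (u 0)" using fu by (simp add: has_L2_fourier_transform_def)
  have norm_u: "norm (u k \<omega>) \<le> m ^ k * norm (u 0 \<omega>)" for k \<omega>
    by (auto simp: u_def norm_mult norm_power intro!: mult_right_mono power_mono)
  have int: "integrable lborel (u k)" for k
  proof (rule Bochner_Integration.integrable_bound)
    have "integrable lborel (indicator {-m..m} :: real \<Rightarrow> real)"
      by (rule integrable_real_indicator) (auto simp: emeasure_lborel_Icc_eq)
    then have "integrable lborel (\<lambda>\<omega>. u 0 \<omega> * complex_of_real (indicator {-m..m} \<omega>))"
      by (intro square_integrable_times_integrable[OF sq, where B = 1] integrable_of_real) (auto simp: indicator_le_1)
    then show "integrable lborel (\<lambda>\<omega>. complex_of_real (m ^ k) * (u 0 \<omega> * complex_of_real (indicator {-m..m} \<omega>)))"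
      by (rule integrable_mult_right)
    show "AE \<omega> in lborel. norm (u k \<omega>) \<le> norm (complex_of_real (m ^ k) * (u 0 \<omega> * complex_of_real (indicator {-m..m} \<omega>)))"
    proof (intro AE_I2)
      fix \<omega>
      have "u 0 \<omega> * complex_of_real (indicator {-m..m} \<omega>) = u 0 \<omega>" by (auto simp: u_def indicator_def)
      then show "norm (u k \<omega>) \<le> norm (complex_of_real (m ^ k) * (u 0 \<omega> * complex_of_real (indicator {-m..m} \<omega>)))"
        using norm_u[of k \<omega>] m by (simp only: norm_mult norm_of_real) simp
    qed
  qed simp
  have u_Suc: "\<i> * complex_of_real \<omega> * u k \<omega> = u (Suc k) \<omega>" for k \<omega>
    by (simp add: u_def)
  have u_2: "\<omega>\<^sup>2 * norm (u k \<omega>) = norm (u (Suc (Suc k)) \<omega>)" for k \<omega>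
    by (simp add: u_def norm_mult norm_power power2_eq_square mult_ac abs_mult_self_eq)
  have Du: "D k a = (1 / (2 * pi)) * (LINT \<omega>|lborel. u k \<omega> * cis (\<omega> * a))" for k a
  proof (induction k arbitrary: a)
    case 0
    have "continuous_on UNIV f"
      using D[of 0] unfolding D0 by (intro continuous_at_imp_continuous_on ballI has_vector_derivative_continuous)
    then show ?case unfolding D0 by (rule L2_fourier_inversion[OF fu int])
  next
    case (Suc k)
    have "((\<lambda>a. LINT \<omega>|lborel. u k \<omega> * cis (\<omega> * a)) has_vector_derivative
        (LINT \<omega>|lborel. u (Suc k) \<omega> * cis (\<omega> * a))) (at a)"
      using has_vector_derivative_fourier_synthesis[OF int[of k], of a] int unfolding u_Suc u_2 by simp
    then have "((\<lambda>a. complex_of_real (1 / (2 * pi)) * (LINT \<omega>|lborel. u k \<omega> * cis (\<omega> * a))) has_vector_derivative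
        complex_of_real (1 / (2 * pi)) * (LINT \<omega>|lborel. u (Suc k) \<omega> * cis (\<omega> * a))) (at a)"
      by (rule has_vector_derivative_mult_right)
    moreover have "(\<lambda>a. complex_of_real (1 / (2 * pi)) * (LINT \<omega>|lborel. u k \<omega> * cis (\<omega> * a))) = D k"
      using Suc.IH by (simp add: fun_eq_iff)
    ultimately have "D (Suc k) a = complex_of_real (1 / (2 * pi)) * (LINT \<omega>|lborel. u (Suc k) \<omega> * cis (\<omega> * a))"
      using vector_derivative_unique_at[OF D[of k a]] by simp
    then show ?case by simp
  qed
  have Df: "D k a = complex_of_real (1 / (2 * pi)) * fourier (u k) (- a)" for k a
    unfolding Du fourier_def by (simp add: mult.commute)
  have "continuous_on UNIV (D k)"
    using D[of k] by (intro continuous_at_imp_continuous_on ballI has_vector_derivative_continuous)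
  then have Dm [measurable]: "D k \<in> borel_measurable borel" by (rule borel_measurable_continuous_onI)
  let ?N = "LINT x|lborel. (norm (f x))\<^sup>2"
  have "(\<integral>\<^sup>+a. ennreal ((norm (D k a))\<^sup>2) \<partial>lborel) = (\<integral>\<^sup>+a. ennreal ((1 / (2 * pi))\<^sup>2) * ennreal ((norm (fourier (u k) (0 + (-1) * a)))\<^sup>2) \<partial>lborel)"
    by (intro nn_integral_cong) (simp add: Df norm_mult power_mult_distrib power_divide ennreal_mult[symmetric] norm_divide)
  also have "\<dots> = ennreal ((1 / (2 * pi))\<^sup>2) * (\<integral>\<^sup>+a. ennreal ((norm (fourier (u k) (0 + (-1) * a)))\<^sup>2) \<partial>lborel)"
    by (rule nn_integral_cmult) measurable
  also have "(\<integral>\<^sup>+a. ennreal ((norm (fourier (u k) (0 + (-1) * a)))\<^sup>2) \<partial>lborel) = (\<integral>\<^sup>+\<omega>. ennreal ((norm (fourier (u k) \<omega>))\<^sup>2) \<partial>lborel)"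
    by (subst (2) nn_integral_real_affine[where c = "-1" and t = 0]) auto
  also have "ennreal ((1 / (2 * pi))\<^sup>2) * \<dots> \<le> ennreal ((1 / (2 * pi))\<^sup>2) * (ennreal (2 * pi) * (\<integral>\<^sup>+\<omega>. ennreal ((norm (u k \<omega>))\<^sup>2) \<partial>lborel))"
    by (intro mult_left_mono fourier_norm_le int) auto
  also have "\<dots> \<le> ennreal ((1 / (2 * pi))\<^sup>2) * (ennreal (2 * pi) * (\<integral>\<^sup>+\<omega>. ennreal ((m ^ k)\<^sup>2) * ennreal ((norm (u 0 \<omega>))\<^sup>2) \<partial>lborel))"
  proof (intro mult_left_mono nn_integral_mono)
    fix \<omega>
    have "(norm (u k \<omega>))\<^sup>2 \<le> (m ^ k * norm (u 0 \<omega>))\<^sup>2" by (intro power_mono norm_u) simp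
    then show "ennreal ((norm (u k \<omega>))\<^sup>2) \<le> ennreal ((m ^ k)\<^sup>2) * ennreal ((norm (u 0 \<omega>))\<^sup>2)"
      by (simp add: power_mult_distrib ennreal_mult[symmetric])
  qed auto
  also have "\<dots> = ennreal ((1 / (2 * pi))\<^sup>2) * (ennreal (2 * pi) * (ennreal ((m ^ k)\<^sup>2) * (\<integral>\<^sup>+\<omega>. ennreal ((norm (u 0 \<omega>))\<^sup>2) \<partial>lborel)))"
    by (simp add: nn_integral_cmult)
  also have "(\<integral>\<^sup>+\<omega>. ennreal ((norm (u 0 \<omega>))\<^sup>2) \<partial>lborel) = ennreal (LINT \<omega>|lborel. (norm (u 0 \<omega>))\<^sup>2)"
    using sq by (intro nn_integral_eq_integral) (auto simp: square_integrable_def)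
  also have "ennreal ((1 / (2 * pi))\<^sup>2) * (ennreal (2 * pi) * (ennreal ((m ^ k)\<^sup>2) * \<dots>)) \<le>
      ennreal ((1 / (2 * pi))\<^sup>2) * (ennreal (2 * pi) * (ennreal ((m ^ k)\<^sup>2) * ennreal (2 * pi * ?N)))"
    by (intro mult_left_mono ennreal_leI L2_fourier_norm_le[OF fu]) auto
  also have "\<dots> = ennreal ((1 / (2 * pi))\<^sup>2 * (2 * pi * ((m ^ k)\<^sup>2 * (2 * pi * ?N))))"
    by (simp add: ennreal_mult[symmetric])
  also have "(1 / (2 * pi))\<^sup>2 * (2 * pi * ((m ^ k)\<^sup>2 * (2 * pi * ?N))) = (m ^ k)\<^sup>2 * ?N"
    by (simp add: power2_eq_square)
  finally have le: "(\<integral>\<^sup>+a. ennreal ((norm (D k a))\<^sup>2) \<partial>lborel) \<le> ennreal ((m ^ k)\<^sup>2 * ?N)" .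
  then show int2: "integrable lborel (\<lambda>x. (norm (D k x))\<^sup>2)"
    by (intro integrableI_bounded) (auto simp: le_less_trans[OF _ ennreal_less_top])
  have "ennreal (LINT x|lborel. (norm (D k x))\<^sup>2) = (\<integral>\<^sup>+a. ennreal ((norm (D k a))\<^sup>2) \<partial>lborel)"
    using int2 by (intro nn_integral_eq_integral[symmetric]) auto
  with le have "ennreal (LINT x|lborel. (norm (D k x))\<^sup>2) \<le> ennreal ((m ^ k)\<^sup>2 * ?N)" by simp
  then show "(LINT x|lborel. (norm (D k x))\<^sup>2) \<le> (m ^ k)\<^sup>2 * ?N"
    by (subst (asm) ennreal_le_iff) auto
qed

text \<open>The complement of the essential support is a union of possibly uncountably many open sets on each of
which \<open>g\<close> vanishes almost everywhere; by the Lindelof property countably many of them suffice.\<close>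
lemma AE_zero_outside_ess_support: "AE \<omega> in lborel. \<omega> \<notin> ess_support g \<longrightarrow> g \<omega> = 0"
proof -
  let ?F = "{U. open U \<and> (AE \<omega> in lborel. \<omega> \<in> U \<longrightarrow> g \<omega> = 0)}"
  obtain F where F: "F \<subseteq> ?F" "countable F" "\<Union>F = \<Union>?F"
    by (rule Lindelof[of ?F]) auto
  have "AE \<omega> in lborel. \<forall>U\<in>F. \<omega> \<in> U \<longrightarrow> g \<omega> = 0"
    using F by (subst AE_ball_countable) auto
  then show ?thesis
    by eventually_elim (use F(3) in \<open>auto simp: ess_support_def\<close>)
qed

section \<open>Interpolation by polynomials\<close>

text \<open>Bounding the new zeros by the least and greatest old ones keeps a zero found beyond the current
maximum distinct from those found before.\<close>
lemma rolle_zeros: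
  fixes w :: "real \<Rightarrow> real"
  assumes w: "\<And>t. (w has_real_derivative w' t) (at t)" and "finite S" "S \<noteq> {}" "\<And>t. t \<in> S \<Longrightarrow> w t = 0"
  shows "\<exists>S'. finite S' \<and> S' \<subseteq> {Min S..Max S} \<and> Suc (card S') = card S \<and> (\<forall>t\<in>S'. w' t = 0)"
  using assms(2-4)
proof (induction S rule: finite_linorder_max_induct)
  case empty
  then show ?case by simp
next
  case (insert b A)
  show ?case
  proof (cases "A = {}")
    case True
    then show ?thesis by (intro exI[of _ "{}"]) auto
  next
    case False
    then obtain S' where S': "finite S'" "S' \<subseteq> {Min A..Max A}" "Suc (card S') = card A" "\<forall>t\<in>S'. w' t = 0"
      using insert.IH insert.prems by auto
    define c where "c = Max A"
    have c: "c \<in> A" "c < b" using insert False by (auto simp: c_def)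
    have "\<exists>z. c < z \<and> z < b \<and> w' z = 0"
    proof -
      have "w c = w b" using insert.prems c by auto
      moreover have "continuous_on {c..b} w"
        using w by (intro continuous_at_imp_continuous_on ballI DERIV_isCont)
      ultimately obtain z where "c < z" "z < b" "(w has_real_derivative 0) (at z)"
        using Rolle[OF c(2), of w] w by (auto simp: real_differentiable_def)
      then show ?thesis using DERIV_unique[OF w] by blast
    qed
    then obtain z where z: "c < z" "z < b" "w' z = 0" by blast
    have zS: "z \<notin> S'" using S'(2) z(1) by (auto simp: c_def)
    have Max: "Max (insert b A) = b" using insert c by (intro Max_eqI) auto
    have Min_le: "Min A \<le> c" using c insert by auto
    then have "Min A \<le> b" using c(2) by linarith
    then have Min: "Min (insert b A) = Min A"
      by (subst Min_insert[OF insert.hyps(1) False]) simp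
    from Min_le have "insert z S' \<subseteq> {Min (insert b A)..Max (insert b A)}"
      unfolding Max Min using S'(2) z c by (auto simp: c_def subset_iff)
    moreover have "b \<notin> A" using insert by auto
    ultimately show ?thesis
      using S' zS z insert by (intro exI[of _ "insert z S'"]) auto
  qed
qed

lemma iterated_rolle:
  fixes E :: "nat \<Rightarrow> real \<Rightarrow> real"
  assumes E: "\<And>k t. (E k has_real_derivative E (Suc k) t) (at t)"
    and "finite S" "card S = Suc n" "S \<subseteq> {a..b}" "\<And>t. t \<in> S \<Longrightarrow> E 0 t = 0"
  shows "\<exists>\<xi>\<in>{a..b}. E n \<xi> = 0"
  using assms
proof (induction n arbitrary: E S)
  case 0
  then show ?case by (auto simp: card_Suc_eq)
next
  case (Suc n)
  have "S \<noteq> {}" using Suc.prems by auto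
  then obtain S' where S': "finite S'" "S' \<subseteq> {Min S..Max S}" "Suc (card S') = card S" "\<forall>t\<in>S'. E (Suc 0) t = 0"
    using rolle_zeros[of "E 0" "E (Suc 0)" S] Suc.prems by auto
  have "Min S \<in> S" "Max S \<in> S" using \<open>S \<noteq> {}\<close> Suc.prems by auto
  then have "S' \<subseteq> {a..b}" using S'(2) Suc.prems(4) by (auto simp: subset_iff) (meson order_trans)+
  then show ?case
    using Suc.IH[of "\<lambda>k. E (Suc k)" S'] S' Suc.prems by auto
qed

definition nodal_poly :: "nat \<Rightarrow> (nat \<Rightarrow> 'a) \<Rightarrow> 'a::comm_ring_1 poly" where
  "nodal_poly s t = (\<Prod>m\<le>s. [:- t m, 1:])"

text \<open>Newton's scheme: a multiple of the nodal polynomial of the old nodes corrects the value at a new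
node.\<close>
lemma interpolation_exists:
  fixes t :: "nat \<Rightarrow> 'a::field"
  assumes "inj_on t {..s}"
  shows "\<exists>p. degree p \<le> s \<and> (\<forall>m\<le>s. poly p (t m) = y m)"
  using assms
proof (induction s)
  case 0
  show ?case by (intro exI[of _ "[:y 0:]"]) auto
next
  case (Suc s)
  then obtain p where p: "degree p \<le> s" "\<And>m. m \<le> s \<Longrightarrow> poly p (t m) = y m"
    using inj_on_subset[OF Suc.prems, of "{..s}"] by auto
  define N where "N = nodal_poly s t"
  have deg: "degree N \<le> Suc s"
  proof -
    have "degree N \<le> (\<Sum>m\<le>s. degree [:- t m, 1:])"
      unfolding N_def nodal_poly_def using degree_prod_sum_le[of "{..s}" "\<lambda>m. [:- t m, 1:]"] by (simp add: o_def)
    then show ?thesis by simp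
  qed
  have N0: "poly N (t m) = 0" if "m \<le> s" for m
    using that by (auto simp: N_def nodal_poly_def poly_prod)
  have N1: "poly N (t (Suc s)) \<noteq> 0"
    using Suc.prems by (auto simp: N_def nodal_poly_def poly_prod dest: inj_onD[OF Suc.prems])
  let ?c = "(y (Suc s) - poly p (t (Suc s))) / poly N (t (Suc s))"
  have "degree (p + smult ?c N) \<le> Suc s"
    using p deg by (intro degree_add_le order_trans[OF degree_smult_le]) auto
  moreover have "poly (p + smult ?c N) (t m) = y m" if "m \<le> Suc s" for m
    using that p N0 N1 by (cases "m = Suc s") auto
  ultimately show ?case by blast
qed

lemma interpolation_unique:
  fixes t :: "nat \<Rightarrow> 'a::idom"
  assumes "inj_on t {..s}" "degree p \<le> s" "degree q \<le> s" "\<And>m. m \<le> s \<Longrightarrow> poly p (t m) = poly q (t m)"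
  shows "p = q"
proof (rule ccontr)
  assume ne: "p \<noteq> q"
  then have "card {z. poly (p - q) z = 0} \<le> degree (p - q)" by (intro card_poly_roots_bound) auto
  also have "\<dots> \<le> s" using assms by (intro degree_diff_le) auto
  finally have "card {z. poly (p - q) z = 0} \<le> s" .
  moreover have "card (t ` {..s}) \<le> card {z. poly (p - q) z = 0}"
    using ne assms by (intro card_mono poly_roots_finite) auto
  ultimately show False using card_image[OF assms(1)] by simp
qed

lemma interp_poly:
  assumes "inj_on t {..s}"
  shows "degree (interp_poly s t f) \<le> s" and "m \<le> s \<Longrightarrow> poly (interp_poly s t f) (complex_of_real (t m)) = f (t m)"
proof -
  have inj: "inj_on (\<lambda>m. complex_of_real (t m)) {..s}" using assms by (simp add: inj_on_def)
  have "\<exists>!p. degree p \<le> s \<and> (\<forall>m\<le>s. poly p (complex_of_real (t m)) = f (t m))"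
    using interpolation_exists[OF inj, of "\<lambda>m. f (t m)"] interpolation_unique[OF inj] by (metis (no_types, lifting))
  from theI'[OF this] show "degree (interp_poly s t f) \<le> s"
    "m \<le> s \<Longrightarrow> poly (interp_poly s t f) (complex_of_real (t m)) = f (t m)"
    unfolding interp_poly_def by auto
qed

lemma interp_poly_eqI:
  assumes "inj_on t {..s}" "degree p \<le> s" "\<And>m. m \<le> s \<Longrightarrow> poly p (complex_of_real (t m)) = f (t m)"
  shows "interp_poly s t f = p"
  using assms interp_poly(1)[OF assms(1), of f] interp_poly(2)[OF assms(1), where f = f]
  by (intro interpolation_unique[of "\<lambda>m. complex_of_real (t m)" s]) (auto simp: inj_on_def)

lemma higher_pderiv_eq_0: "degree p < n \<Longrightarrow> (pderiv ^^ n) p = (0 :: 'a::field_char_0 poly)"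
  by (intro poly_eqI) (simp add: coeff_higher_pderiv coeff_eq_0)

lemma poly_higher_pderiv_monic:
  fixes p :: "'a::field_char_0 poly"
  assumes "degree p = n" "lead_coeff p = 1"
  shows "poly ((pderiv ^^ n) p) x = fact n"
proof -
  have "(pderiv ^^ n) p = [:fact n:]"
    using assms by (intro poly_eqI) (auto simp: coeff_higher_pderiv coeff_pCons pochhammer_fact coeff_eq_0 split: nat.splits)
  then show ?thesis by simp
qed

text \<open>For real functions, subtract from \<open>f - p\<close> the multiple of the nodal polynomial that makes the
difference vanish at \<open>y\<close> as well. It has \<open>s + 2\<close> zeros, so its derivative of order \<open>s + 1\<close> has one;
there the interpolant contributes nothing and the nodal polynomial contributes \<open>(s + 1)!\<close>. Since
Rolle's theorem fails for complex values, \<open>f - p\<close> is first rotated so that it is real and nonnegative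
at \<open>y\<close>, and its real part is taken.\<close>
lemma interpolation_error:
  fixes D :: "nat \<Rightarrow> real \<Rightarrow> complex" and p :: "complex poly" and t :: "nat \<Rightarrow> real"
  assumes D: "\<And>k x. (D k has_vector_derivative D (Suc k) x) (at x)"
    and p: "degree p \<le> s" "\<And>m. m \<le> s \<Longrightarrow> poly p (complex_of_real (t m)) = D 0 (t m)"
    and t: "inj_on t {..s}" "\<And>m. m \<le> s \<Longrightarrow> t m \<in> {a..b}" and y: "y \<in> {a..b}"
  shows "\<exists>\<xi>\<in>{a..b}. norm (D 0 y - poly p (complex_of_real y)) \<le> norm (D (Suc s) \<xi>) / fact (Suc s) * (\<Prod>m\<le>s. \<bar>y - t m\<bar>)"
proof (cases "y \<in> t ` {..s}")
  case True
  then show ?thesis using p y by (intro bexI[OF _ y]) (auto intro!: divide_nonneg_nonneg mult_nonneg_nonneg prod_nonneg)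
next
  case False
  define N where "N = nodal_poly s t"
  have N_mult: "poly N z = (\<Prod>m\<le>s. z - t m)" for z
    by (simp add: N_def nodal_poly_def poly_prod)
  have N_deg: "degree N = Suc s"
    unfolding N_def nodal_poly_def by (subst degree_prod_eq_sum_degree) auto
  have N_lead: "lead_coeff N = 1"
    by (simp add: N_def nodal_poly_def lead_coeff_prod)
  have Ny: "poly N y \<noteq> 0" using False by (auto simp: N_mult)
  let ?e = "D 0 y - poly p (complex_of_real y)"
  \<comment> \<open>The rotation that makes the error at \<open>y\<close> equal to its modulus.\<close>
  define c where "c = cnj (sgn ?e)"
  have c1: "norm c \<le> 1" by (simp add: c_def norm_sgn)
  have ce: "c * ?e = complex_of_real (norm ?e)"
  proof (cases "?e = 0")
    case False
    have "cnj ?e * ?e = complex_of_real ((norm ?e)\<^sup>2)"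
      by (metis complex_norm_square mult.commute)
    then show ?thesis using False
      by (simp add: c_def sgn_div_norm scaleR_conv_of_real field_simps power2_eq_square)
  qed simp
  define \<kappa> where "\<kappa> = norm ?e / poly N y"
  define E where "E k x = Re (c * (D k x - poly ((pderiv ^^ k) p) (complex_of_real x))) - \<kappa> * poly ((pderiv ^^ k) N) x" for k x
  have "\<exists>\<xi>\<in>{a..b}. E (Suc s) \<xi> = 0"
  proof (rule iterated_rolle[where S = "insert y (t ` {..s})"])
    fix k x
    have P: "((\<lambda>x. poly ((pderiv ^^ k) p) (complex_of_real x)) has_vector_derivative poly ((pderiv ^^ Suc k) p) (complex_of_real x)) (at x)"
      using has_vector_derivative_real_field[OF poly_DERIV[of "(pderiv ^^ k) p" "complex_of_real x"]] by simp
    have "((\<lambda>x. Re (c * (D k x - poly ((pderiv ^^ k) p) (complex_of_real x)))) has_vector_derivative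
        Re (c * (D (Suc k) x - poly ((pderiv ^^ Suc k) p) (complex_of_real x)))) (at x)"
      by (intro bounded_linear.has_vector_derivative[OF bounded_linear_Re] has_vector_derivative_mult_right has_vector_derivative_diff D P)
    then have "((\<lambda>x. Re (c * (D k x - poly ((pderiv ^^ k) p) (complex_of_real x)))) has_real_derivative
        Re (c * (D (Suc k) x - poly ((pderiv ^^ Suc k) p) (complex_of_real x)))) (at x)"
      by (simp only: has_real_derivative_iff_has_vector_derivative)
    moreover have "((\<lambda>x. \<kappa> * poly ((pderiv ^^ k) N) x) has_real_derivative \<kappa> * poly ((pderiv ^^ Suc k) N) x) (at x)"
      using poly_DERIV[of "(pderiv ^^ k) N" x] by (intro DERIV_cmult) simp
    ultimately show "(E k has_real_derivative E (Suc k) x) (at x)"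
      unfolding E_def by (rule DERIV_diff)
  next
    show "card (insert y (t ` {..s})) = Suc (Suc s)"
      using False card_image[OF t(1)] by simp
    show "insert y (t ` {..s}) \<subseteq> {a..b}" using t(2) y by auto
    fix z assume "z \<in> insert y (t ` {..s})"
    then consider "z = y" | m where "m \<le> s" "z = t m" by auto
    then show "E 0 z = 0"
    proof cases
      case 1
      then show ?thesis using ce Ny by (simp add: E_def \<kappa>_def)
    next
      case 2
      then show ?thesis using p(2) by (auto simp: E_def N_mult)
    qed
  qed simp
  then obtain \<xi> where \<xi>: "\<xi> \<in> {a..b}" "E (Suc s) \<xi> = 0" by blast
  have "(pderiv ^^ Suc s) p = 0" using p(1) by (intro higher_pderiv_eq_0) simp
  moreover have "poly ((pderiv ^^ Suc s) N) \<xi> = fact (Suc s)"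
    by (rule poly_higher_pderiv_monic[OF N_deg N_lead])
  ultimately have "Re (c * D (Suc s) \<xi>) = \<kappa> * fact (Suc s)"
    using \<xi>(2) unfolding E_def by simp
  then have "\<bar>\<kappa>\<bar> * fact (Suc s) = \<bar>Re (c * D (Suc s) \<xi>)\<bar>" by (simp add: abs_mult)
  also have "\<dots> \<le> norm c * norm (D (Suc s) \<xi>)" using abs_Re_le_cmod[of "c * D (Suc s) \<xi>"] by (simp add: norm_mult)
  also have "\<dots> \<le> norm (D (Suc s) \<xi>)" using c1 by (simp add: mult_left_le_one_le)
  finally have "\<bar>\<kappa>\<bar> \<le> norm (D (Suc s) \<xi>) / fact (Suc s)"
    by (subst pos_le_divide_eq) auto
  then have "\<bar>\<kappa>\<bar> * \<bar>poly N y\<bar> \<le> norm (D (Suc s) \<xi>) / fact (Suc s) * (\<Prod>m\<le>s. \<bar>y - t m\<bar>)"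
    unfolding N_mult abs_prod by (intro mult_right_mono prod_nonneg) auto
  moreover have "norm ?e = \<bar>\<kappa>\<bar> * \<bar>poly N y\<bar>" using Ny by (simp add: \<kappa>_def abs_mult[symmetric])
  ultimately show ?thesis using \<xi>(1) by auto
qed

section \<open>Wirtinger's inequality\<close>

text \<open>Jacobi's argument. For \<open>\<kappa> < \<pi> / (2 (b - a))\<close> the function \<open>c t = \<kappa> tan (\<kappa> (e - t))\<close> is smooth on the
interval and solves the Riccati equation \<open>c' = - \<kappa>\<^sup>2 - c\<^sup>2\<close>. Therefore
\<open>F'\<^sup>2 - \<kappa>\<^sup>2 F\<^sup>2 = (F' - c F)\<^sup>2 + (c F\<^sup>2)'\<close>, and the boundary terms vanish because \<open>F\<close> is zero at one end
point and \<open>c\<close> at the other one, \<open>e\<close>. Then \<open>\<kappa>\<close> tends to its limit.\<close>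
lemma wirtinger_real:
  fixes F F' :: "real \<Rightarrow> real"
  assumes F: "\<And>t. (F has_real_derivative F' t) (at t)" and F': "continuous_on UNIV F'"
    and ab: "a \<le> b" and ends: "F a = 0 \<and> e = b \<or> F b = 0 \<and> e = a"
  shows "integral {a..b} (\<lambda>t. (F t)\<^sup>2) \<le> (2 * (b - a) / pi)\<^sup>2 * integral {a..b} (\<lambda>t. (F' t)\<^sup>2)"
proof (cases "a = b")
  case False
  define L where "L = b - a"
  have L: "0 < L" using ab False by (simp add: L_def)
  have Fc: "continuous_on UNIV F"
    using F by (intro continuous_at_imp_continuous_on ballI DERIV_isCont)
  have int: "(\<lambda>t. (F t)\<^sup>2) integrable_on {a..b}" "(\<lambda>t. (F' t)\<^sup>2) integrable_on {a..b}"
    using continuous_on_subset[OF Fc] continuous_on_subset[OF F']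
    by (auto intro!: integrable_continuous_real continuous_intros)
  have le: "\<kappa>\<^sup>2 * integral {a..b} (\<lambda>t. (F t)\<^sup>2) \<le> integral {a..b} (\<lambda>t. (F' t)\<^sup>2)"
    if \<kappa>: "0 < \<kappa>" "\<kappa> < pi / (2 * L)" for \<kappa>
  proof -
    define c where "c t = \<kappa> * tan (\<kappa> * (e - t))" for t
    have cos: "cos (\<kappa> * (e - t)) \<noteq> 0" if "t \<in> {a..b}" for t
    proof -
      have "\<bar>e - t\<bar> \<le> L" using that ends by (auto simp: L_def)
      then have "\<bar>\<kappa> * (e - t)\<bar> \<le> \<kappa> * L" using \<kappa> by (simp add: abs_mult)
      also have "\<kappa> * L < pi / 2" using \<kappa> L by (simp add: field_simps)
      finally have "0 < cos (\<kappa> * (e - t))" by (intro cos_gt_zero_pi) auto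
      then show ?thesis by simp
    qed
    have "((\<lambda>t. - \<kappa>\<^sup>2 * (F t)\<^sup>2 - (c t)\<^sup>2 * (F t)\<^sup>2 + 2 * c t * F t * F' t) has_integral (c b * (F b)\<^sup>2 - c a * (F a)\<^sup>2)) {a..b}"
    proof (rule fundamental_theorem_of_calculus[OF ab])
      fix t assume t: "t \<in> {a..b}"
      have "((\<lambda>t. tan (\<kappa> * (e - t))) has_real_derivative - \<kappa> * inverse ((cos (\<kappa> * (e - t)))\<^sup>2)) (at t)"
        using cos[OF t] by (auto intro!: derivative_eq_intros)
      moreover have "inverse ((cos (\<kappa> * (e - t)))\<^sup>2) = 1 + (tan (\<kappa> * (e - t)))\<^sup>2"
        using tan_sec[OF cos[OF t]] by (simp add: power_inverse)
      ultimately have "(c has_real_derivative \<kappa> * (- \<kappa> * (1 + (tan (\<kappa> * (e - t)))\<^sup>2))) (at t)"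
        unfolding c_def by (intro DERIV_cmult) simp
      then have "(c has_real_derivative - \<kappa>\<^sup>2 - (c t)\<^sup>2) (at t)"
        by (simp add: c_def algebra_simps power2_eq_square)
      moreover have "((\<lambda>t. (F t)\<^sup>2) has_real_derivative 2 * F t * F' t) (at t)"
        by (auto intro!: derivative_eq_intros F)
      ultimately have "((\<lambda>t. c t * (F t)\<^sup>2) has_real_derivative (- \<kappa>\<^sup>2 - (c t)\<^sup>2) * (F t)\<^sup>2 + 2 * F t * F' t * c t) (at t)"
        by (rule DERIV_mult)
      then have "((\<lambda>t. c t * (F t)\<^sup>2) has_real_derivative - \<kappa>\<^sup>2 * (F t)\<^sup>2 - (c t)\<^sup>2 * (F t)\<^sup>2 + 2 * c t * F t * F' t) (at t)"
        by (simp add: algebra_simps)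
      then show "((\<lambda>t. c t * (F t)\<^sup>2) has_vector_derivative - \<kappa>\<^sup>2 * (F t)\<^sup>2 - (c t)\<^sup>2 * (F t)\<^sup>2 + 2 * c t * F t * F' t) (at t within {a..b})"
        by (simp add: has_real_derivative_iff_has_vector_derivative has_vector_derivative_at_within)
    qed
    moreover have "c b * (F b)\<^sup>2 - c a * (F a)\<^sup>2 = 0" using ends by (auto simp: c_def)
    ultimately have "((\<lambda>t. - \<kappa>\<^sup>2 * (F t)\<^sup>2 - (c t)\<^sup>2 * (F t)\<^sup>2 + 2 * c t * F t * F' t) has_integral 0) {a..b}"
      by simp
    moreover have "((\<lambda>t. (F' t)\<^sup>2 - \<kappa>\<^sup>2 * (F t)\<^sup>2) has_integral
        integral {a..b} (\<lambda>t. (F' t)\<^sup>2) - \<kappa>\<^sup>2 * integral {a..b} (\<lambda>t. (F t)\<^sup>2)) {a..b}"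
      using int by (intro has_integral_diff has_integral_mult_right integrable_integral)
    ultimately have "0 \<le> integral {a..b} (\<lambda>t. (F' t)\<^sup>2) - \<kappa>\<^sup>2 * integral {a..b} (\<lambda>t. (F t)\<^sup>2)"
    proof (rule has_integral_le)
      fix t
      have "0 \<le> (F' t - c t * F t)\<^sup>2" by simp
      then show "- \<kappa>\<^sup>2 * (F t)\<^sup>2 - (c t)\<^sup>2 * (F t)\<^sup>2 + 2 * c t * F t * F' t \<le> (F' t)\<^sup>2 - \<kappa>\<^sup>2 * (F t)\<^sup>2"
        by (simp add: power2_eq_square algebra_simps)
    qed
    then show ?thesis by simp
  qed
  have "((\<lambda>\<kappa>. \<kappa>\<^sup>2 * integral {a..b} (\<lambda>t. (F t)\<^sup>2)) \<longlongrightarrow> (pi / (2 * L))\<^sup>2 * integral {a..b} (\<lambda>t. (F t)\<^sup>2)) (at_left (pi / (2 * L)))"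
    by (intro tendsto_intros)
  moreover have "eventually (\<lambda>\<kappa>. \<kappa>\<^sup>2 * integral {a..b} (\<lambda>t. (F t)\<^sup>2) \<le> integral {a..b} (\<lambda>t. (F' t)\<^sup>2)) (at_left (pi / (2 * L)))"
    unfolding eventually_at_left_field using le L by (intro exI[of _ 0]) auto
  ultimately have "(pi / (2 * L))\<^sup>2 * integral {a..b} (\<lambda>t. (F t)\<^sup>2) \<le> integral {a..b} (\<lambda>t. (F' t)\<^sup>2)"
    by (intro tendsto_upperbound) auto
  then have "(2 * L / pi)\<^sup>2 * ((pi / (2 * L))\<^sup>2 * integral {a..b} (\<lambda>t. (F t)\<^sup>2)) \<le> (2 * L / pi)\<^sup>2 * integral {a..b} (\<lambda>t. (F' t)\<^sup>2)"
    by (intro mult_left_mono) auto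
  moreover have "(2 * L / pi)\<^sup>2 * (pi / (2 * L))\<^sup>2 = 1"
    using L by (simp add: power_mult_distrib[symmetric])
  ultimately show ?thesis by (simp add: mult.assoc[symmetric] L_def)
qed simp

lemma wirtinger_complex:
  fixes F F' :: "real \<Rightarrow> complex"
  assumes F: "\<And>t. (F has_vector_derivative F' t) (at t)" and F': "continuous_on UNIV F'"
    and ab: "a \<le> b" and ends: "F a = 0 \<or> F b = 0"
  shows "integral {a..b} (\<lambda>t. (norm (F t))\<^sup>2) \<le> (2 * (b - a) / pi)\<^sup>2 * integral {a..b} (\<lambda>t. (norm (F' t))\<^sup>2)"
proof -
  obtain e where e: "F a = 0 \<and> e = b \<or> F b = 0 \<and> e = a" using ends by blast
  have Fc: "continuous_on UNIV F"
    using F by (intro continuous_at_imp_continuous_on ballI has_vector_derivative_continuous)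
  have R: "((\<lambda>t. Re (F t)) has_real_derivative Re (F' t)) (at t)" for t
    using bounded_linear.has_vector_derivative[OF bounded_linear_Re F[of t]]
    by (simp add: has_real_derivative_iff_has_vector_derivative)
  have I: "((\<lambda>t. Im (F t)) has_real_derivative Im (F' t)) (at t)" for t
    using bounded_linear.has_vector_derivative[OF bounded_linear_Im F[of t]]
    by (simp add: has_real_derivative_iff_has_vector_derivative)
  have int: "(\<lambda>t. (Re (G t))\<^sup>2) integrable_on {a..b}" "(\<lambda>t. (Im (G t))\<^sup>2) integrable_on {a..b}"
    if "continuous_on UNIV G" for G :: "real \<Rightarrow> complex"
    using continuous_on_subset[OF that] by (auto intro!: integrable_continuous_real continuous_intros)
  have split: "integral {a..b} (\<lambda>t. (norm (G t))\<^sup>2) = integral {a..b} (\<lambda>t. (Re (G t))\<^sup>2) + integral {a..b} (\<lambda>t. (Im (G t))\<^sup>2)"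
    if "continuous_on UNIV G" for G :: "real \<Rightarrow> complex"
    unfolding cmod_power2 by (rule Henstock_Kurzweil_Integration.integral_add[OF int[OF that]])
  have "integral {a..b} (\<lambda>t. (Re (F t))\<^sup>2) \<le> (2 * (b - a) / pi)\<^sup>2 * integral {a..b} (\<lambda>t. (Re (F' t))\<^sup>2)"
    using e by (intro wirtinger_real[OF R _ ab, of e] continuous_intros F') auto
  moreover have "integral {a..b} (\<lambda>t. (Im (F t))\<^sup>2) \<le> (2 * (b - a) / pi)\<^sup>2 * integral {a..b} (\<lambda>t. (Im (F' t))\<^sup>2)"
    using e by (intro wirtinger_real[OF I _ ab, of e] continuous_intros F') auto
  ultimately show ?thesis
    unfolding split[OF Fc] split[OF F'] by (simp add: distrib_left)
qed

text \<open>\<open>F - F \<xi>\<close> vanishes at an end point of both \<open>{a..\<xi>}\<close> and \<open>{\<xi>..b}\<close>, and neither is longer than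
\<open>{a..b}\<close>.\<close>
lemma oscillation_bound:
  fixes F F' :: "real \<Rightarrow> complex"
  assumes F: "\<And>t. (F has_vector_derivative F' t) (at t)" and F': "continuous_on UNIV F'"
    and \<xi>: "\<xi> \<in> {a..b}"
  shows "integral {a..b} (\<lambda>t. (norm (F t - F \<xi>))\<^sup>2) \<le> (2 * (b - a) / pi)\<^sup>2 * integral {a..b} (\<lambda>t. (norm (F' t))\<^sup>2)"
proof -
  have G: "((\<lambda>t. F t - F \<xi>) has_vector_derivative F' t) (at t)" for t
    using has_vector_derivative_diff[OF F[of t] has_vector_derivative_const[of "F \<xi>"]] by simp
  have Gc: "continuous_on UNIV (\<lambda>t. F t - F \<xi>)"
    using G by (intro continuous_at_imp_continuous_on ballI has_vector_derivative_continuous)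
  have int: "(\<lambda>t. (norm (H t))\<^sup>2) integrable_on {c..d}" if "continuous_on UNIV H" for H :: "real \<Rightarrow> complex" and c d
    using continuous_on_subset[OF that] by (auto intro!: integrable_continuous_real continuous_intros)
  have mono: "(2 * (d - c) / pi)\<^sup>2 * integral {c..d} (\<lambda>t. (norm (F' t))\<^sup>2) \<le> (2 * (b - a) / pi)\<^sup>2 * integral {c..d} (\<lambda>t. (norm (F' t))\<^sup>2)"
    if "a \<le> c" "c \<le> d" "d \<le> b" for c d
    using that by (intro mult_right_mono power_mono divide_right_mono integral_nonneg int F') auto
  have "integral {a..\<xi>} (\<lambda>t. (norm (F t - F \<xi>))\<^sup>2) \<le> (2 * (b - a) / pi)\<^sup>2 * integral {a..\<xi>} (\<lambda>t. (norm (F' t))\<^sup>2)"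
    using \<xi> by (intro order_trans[OF wirtinger_complex[OF G F'] mono]) auto
  moreover have "integral {\<xi>..b} (\<lambda>t. (norm (F t - F \<xi>))\<^sup>2) \<le> (2 * (b - a) / pi)\<^sup>2 * integral {\<xi>..b} (\<lambda>t. (norm (F' t))\<^sup>2)"
    using \<xi> by (intro order_trans[OF wirtinger_complex[OF G F'] mono]) auto
  moreover have "integral {a..\<xi>} (\<lambda>t. (norm (H t))\<^sup>2) + integral {\<xi>..b} (\<lambda>t. (norm (H t))\<^sup>2) = integral {a..b} (\<lambda>t. (norm (H t))\<^sup>2)"
    if "continuous_on UNIV H" for H :: "real \<Rightarrow> complex"
    using \<xi> by (intro Henstock_Kurzweil_Integration.integral_combine int that) auto
  from this[OF Gc] this[OF F'] have
    "integral {a..b} (\<lambda>t. (norm (F t - F \<xi>))\<^sup>2) = integral {a..\<xi>} (\<lambda>t. (norm (F t - F \<xi>))\<^sup>2) + integral {\<xi>..b} (\<lambda>t. (norm (F t - F \<xi>))\<^sup>2)"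
    "integral {a..b} (\<lambda>t. (norm (F' t))\<^sup>2) = integral {a..\<xi>} (\<lambda>t. (norm (F' t))\<^sup>2) + integral {\<xi>..b} (\<lambda>t. (norm (F' t))\<^sup>2)"
    by simp_all
  ultimately show ?thesis by (simp only: distrib_left)
qed

text \<open>The constant \<open>F \<xi>\<close> at a maximiser \<open>\<xi>\<close> of \<open>\<bar>F\<bar>\<close> is compared with \<open>F\<close>, and the difference is the
oscillation.\<close>
lemma maximum_norm_bound:
  fixes F F' :: "real \<Rightarrow> complex"
  assumes F: "\<And>t. (F has_vector_derivative F' t) (at t)" and F': "continuous_on UNIV F'"
    and ab: "a \<le> b" and t: "0 < t"
  shows "\<exists>M. (\<forall>y\<in>{a..b}. norm (F y) \<le> M) \<and> (b - a) * M\<^sup>2 \<le>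
    (1 + t) * integral {a..b} (\<lambda>y. (norm (F y))\<^sup>2) +
    (1 + 1 / t) * ((2 * (b - a) / pi)\<^sup>2 * integral {a..b} (\<lambda>y. (norm (F' y))\<^sup>2))"
proof -
  have Fc: "continuous_on UNIV F"
    using F by (intro continuous_at_imp_continuous_on ballI has_vector_derivative_continuous)
  obtain \<xi> where \<xi>: "\<xi> \<in> {a..b}" "\<forall>y\<in>{a..b}. norm (F y) \<le> norm (F \<xi>)"
    using continuous_attains_sup[of "{a..b}" "\<lambda>y. norm (F y)"] ab continuous_on_subset[OF Fc]
    by (force intro!: continuous_intros)
  have int: "(\<lambda>y. (norm (F y))\<^sup>2) integrable_on {a..b}" "(\<lambda>y. (norm (F y - F \<xi>))\<^sup>2) integrable_on {a..b}"
    using continuous_on_subset[OF Fc] by (auto intro!: integrable_continuous_real continuous_intros)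
  have "((\<lambda>y. (norm (F \<xi>))\<^sup>2) has_integral (b - a) * (norm (F \<xi>))\<^sup>2) {a..b}"
    using has_integral_const_real[of "(norm (F \<xi>))\<^sup>2" a b] ab by simp
  moreover have "((\<lambda>y. (1 + t) * (norm (F y))\<^sup>2 + (1 + 1 / t) * (norm (F y - F \<xi>))\<^sup>2) has_integral
     (1 + t) * integral {a..b} (\<lambda>y. (norm (F y))\<^sup>2) + (1 + 1 / t) * integral {a..b} (\<lambda>y. (norm (F y - F \<xi>))\<^sup>2)) {a..b}"
    using int by (intro has_integral_add has_integral_mult_right integrable_integral)
  ultimately have "(b - a) * (norm (F \<xi>))\<^sup>2 \<le> (1 + t) * integral {a..b} (\<lambda>y. (norm (F y))\<^sup>2) + (1 + 1 / t) * integral {a..b} (\<lambda>y. (norm (F y - F \<xi>))\<^sup>2)"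
    by (rule has_integral_le) (use norm_power2_le_weighted[OF t, of "F \<xi>"] in \<open>simp add: norm_minus_commute\<close>)
  moreover have "(1 + 1 / t) * integral {a..b} (\<lambda>y. (norm (F y - F \<xi>))\<^sup>2) \<le> (1 + 1 / t) * ((2 * (b - a) / pi)\<^sup>2 * integral {a..b} (\<lambda>y. (norm (F' y))\<^sup>2))"
    using t by (intro mult_left_mono oscillation_bound[OF F F' \<xi>(1)]) auto
  ultimately show ?thesis using \<xi>(2) by (intro exI[of _ "norm (F \<xi>)"]) auto
qed

section \<open>The interpolation error on one interval\<close>

text \<open>The squared maximum of \<open>\<bar>f\<^sup>(\<^sup>s\<^sup>+\<^sup>1\<^sup>)\<bar>\<close> times the length of the interval is bounded by integrals over the
interval. In this form the estimate can be summed over a partition.\<close>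
lemma local_interpolation_error:
  fixes D :: "nat \<Rightarrow> real \<Rightarrow> complex" and p :: "complex poly" and x :: "nat \<Rightarrow> real"
  assumes D: "\<And>k y. (D k has_vector_derivative D (Suc k) y) (at y)"
    and p: "degree p \<le> s" "\<And>m. m \<le> s \<Longrightarrow> poly p (complex_of_real (x m)) = D 0 (x m)"
    and x: "inj_on x {..s}" "\<And>m. m \<le> s \<Longrightarrow> x m \<in> {a..b}"
    and ab: "a \<le> b" and len: "b - a \<le> 2 * \<delta>" and Q: "\<And>y. y \<in> {a..b} \<Longrightarrow> (\<Prod>m\<le>s. \<bar>y - x m\<bar>) \<le> Q"
    and t: "0 < t"
  shows "integral {a..b} (\<lambda>y. (norm (D 0 y - poly p (complex_of_real y)))\<^sup>2) \<le>
    (Q / fact (Suc s))\<^sup>2 * ((1 + t) * integral {a..b} (\<lambda>y. (norm (D (Suc s) y))\<^sup>2) +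
      (1 + 1 / t) * ((4 * \<delta> / pi)\<^sup>2 * integral {a..b} (\<lambda>y. (norm (D (Suc (Suc s)) y))\<^sup>2)))"
proof -
  have Dc: "continuous_on A (D k)" for k A
    using D by (intro continuous_at_imp_continuous_on ballI has_vector_derivative_continuous)
  obtain M where M: "\<And>y. y \<in> {a..b} \<Longrightarrow> norm (D (Suc s) y) \<le> M"
    and M_le: "(b - a) * M\<^sup>2 \<le> (1 + t) * integral {a..b} (\<lambda>y. (norm (D (Suc s) y))\<^sup>2) +
    (1 + 1 / t) * ((2 * (b - a) / pi)\<^sup>2 * integral {a..b} (\<lambda>y. (norm (D (Suc (Suc s)) y))\<^sup>2))"
    using maximum_norm_bound[OF D Dc ab t] by blast
  have Q0: "0 \<le> Q" using Q[of a] ab by (smt (verit) atLeastAtMost_iff prod_nonneg abs_ge_zero)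
  have pw: "norm (D 0 y - poly p (complex_of_real y)) \<le> M / fact (Suc s) * Q" if y: "y \<in> {a..b}" for y
  proof -
    obtain \<xi> where \<xi>: "\<xi> \<in> {a..b}"
      "norm (D 0 y - poly p (complex_of_real y)) \<le> norm (D (Suc s) \<xi>) / fact (Suc s) * (\<Prod>m\<le>s. \<bar>y - x m\<bar>)"
      using interpolation_error[OF D p x y] by blast
    note \<xi>(2)
    also have "norm (D (Suc s) \<xi>) / fact (Suc s) * (\<Prod>m\<le>s. \<bar>y - x m\<bar>) \<le> M / fact (Suc s) * Q"
      using M[OF \<xi>(1)] Q[OF y] Q0 norm_ge_zero[of "D (Suc s) \<xi>"]
      by (intro mult_mono divide_right_mono) (auto intro: prod_nonneg simp del: norm_ge_zero)
    finally show ?thesis .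
  qed
  have "((\<lambda>y. (norm (D 0 y - poly p (complex_of_real y)))\<^sup>2) has_integral
      integral {a..b} (\<lambda>y. (norm (D 0 y - poly p (complex_of_real y)))\<^sup>2)) {a..b}"
    by (intro integrable_integral integrable_continuous_real continuous_intros Dc)
  moreover have "((\<lambda>y. (M / fact (Suc s) * Q)\<^sup>2) has_integral (b - a) * (M / fact (Suc s) * Q)\<^sup>2) {a..b}"
    using has_integral_const_real[of "(M / fact (Suc s) * Q)\<^sup>2" a b] ab by simp
  ultimately have "integral {a..b} (\<lambda>y. (norm (D 0 y - poly p (complex_of_real y)))\<^sup>2) \<le> (b - a) * (M / fact (Suc s) * Q)\<^sup>2"
    by (rule has_integral_le) (intro power_mono pw norm_ge_zero)
  also have "\<dots> = (Q / fact (Suc s))\<^sup>2 * ((b - a) * M\<^sup>2)"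
    by (simp add: power_mult_distrib power_divide)
  also have "\<dots> \<le> (Q / fact (Suc s))\<^sup>2 * ((1 + t) * integral {a..b} (\<lambda>y. (norm (D (Suc s) y))\<^sup>2) +
      (1 + 1 / t) * ((2 * (b - a) / pi)\<^sup>2 * integral {a..b} (\<lambda>y. (norm (D (Suc (Suc s)) y))\<^sup>2)))"
    by (intro mult_left_mono M_le) simp
  also have "\<dots> \<le> (Q / fact (Suc s))\<^sup>2 * ((1 + t) * integral {a..b} (\<lambda>y. (norm (D (Suc s) y))\<^sup>2) +
      (1 + 1 / t) * ((4 * \<delta> / pi)\<^sup>2 * integral {a..b} (\<lambda>y. (norm (D (Suc (Suc s)) y))\<^sup>2)))"
    using t ab len
    by (intro mult_left_mono add_left_mono mult_right_mono power_mono divide_right_mono integral_nonneg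
        integrable_continuous_real continuous_intros Dc) auto
  finally show ?thesis .
qed

section \<open>Voronoi regions and bunched sampling sets\<close>

text \<open>If \<open>c n\<close> is a nearest centre to \<open>y\<close>, its distance is the infimum in the definition of the density.\<close>
lemma voronoi_within_density:
  assumes \<delta>: "0 \<le> \<delta>" "sampling_density I c = ennreal \<delta>" and n: "n \<in> I" and y: "y \<in> voronoi I c n"
  shows "\<bar>y - c n\<bar> \<le> \<delta>"
proof -
  have "ennreal \<bar>y - c n\<bar> \<le> (INF l\<in>I. ennreal \<bar>y - c l\<bar>)"
  proof (rule INF_greatest)
    fix l assume "l \<in> I"
    then show "ennreal \<bar>y - c n\<bar> \<le> ennreal \<bar>y - c l\<bar>"
      using y by (cases "l = n") (auto simp: voronoi_def intro!: ennreal_leI)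
  qed
  also have "\<dots> \<le> sampling_density I c"
    unfolding sampling_density_def by (rule SUP_upper) simp
  finally show ?thesis using \<delta> by (simp add: ennreal_le_iff)
qed

text \<open>Each condition \<open>\<bar>y - c n\<bar> \<le> \<bar>y - c l\<bar>\<close> cuts out a closed half-line (or the whole line), and the
density bounds the distance from \<open>c n\<close>.\<close>
lemma voronoi_eq_interval:
  assumes \<delta>: "0 \<le> \<delta>" "sampling_density I c = ennreal \<delta>" and n: "n \<in> I"
  shows "\<exists>a b. a \<le> b \<and> b - a \<le> 2 * \<delta> \<and> voronoi I c n = {a..b}"
proof -
  let ?V = "voronoi I c n"
  have cn: "c n \<in> ?V" by (simp add: voronoi_def)
  have "closed {y. \<bar>y - c n\<bar> \<le> \<bar>y - c l\<bar>}" for l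
    by (intro closed_Collect_le continuous_intros)
  moreover have "?V = (\<Inter>l\<in>I - {n}. {y. \<bar>y - c n\<bar> \<le> \<bar>y - c l\<bar>})" by (auto simp: voronoi_def)
  ultimately have "closed ?V" by auto
  moreover have "bounded ?V"
    using voronoi_within_density[OF \<delta> n] by (intro boundedI[where B = "\<delta> + \<bar>c n\<bar>"]) fastforce
  ultimately have "compact ?V" by (simp add: compact_eq_bounded_closed)
  moreover have "is_interval ?V"
    unfolding is_interval_1
  proof (intro ballI allI impI)
    fix y1 y2 y assume y: "y1 \<in> ?V" "y2 \<in> ?V" "y1 \<le> y \<and> y \<le> y2"
    show "y \<in> ?V"
      unfolding voronoi_def
    proof (intro CollectI ballI impI)
      fix l assume "l \<in> I" "l \<noteq> n"
      then have "\<bar>y1 - c n\<bar> \<le> \<bar>y1 - c l\<bar>" "\<bar>y2 - c n\<bar> \<le> \<bar>y2 - c l\<bar>"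
        using y by (auto simp: voronoi_def)
      then show "\<bar>y - c n\<bar> \<le> \<bar>y - c l\<bar>" using y(3) by linarith
    qed
  qed
  ultimately obtain a b where ab: "?V = {a..b}"
    using is_interval_compact[of ?V] by (metis box_real(2))
  then have "a \<le> b" using cn by auto
  moreover have "\<bar>a - c n\<bar> \<le> \<delta>" "\<bar>b - c n\<bar> \<le> \<delta>"
    using voronoi_within_density[OF \<delta> n] ab \<open>a \<le> b\<close> by auto
  ultimately show ?thesis using ab by (intro exI[of _ a] exI[of _ b]) auto
qed

text \<open>The centre contributes a factor \<open>\<delta>\<close>, and each of the \<open>s\<close> further nodes, at distance at most \<open>h\<close> from
the centre, a factor \<open>\<delta> + h\<close>.\<close>
lemma nodal_product_le:
  fixes x :: "nat \<Rightarrow> real" and y \<delta> h :: real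
  assumes "0 \<le> \<delta>" "0 \<le> h" "\<bar>y - x 0\<bar> \<le> \<delta>" and x: "\<And>m. m \<in> {1..s} \<Longrightarrow> \<bar>x m - x 0\<bar> \<le> h"
  shows "(\<Prod>m\<le>s. \<bar>y - x m\<bar>) \<le> \<delta> * (\<delta> + h) ^ s"
proof -
  have "{..s} = insert 0 {1..s}" by auto
  then have "(\<Prod>m\<le>s. \<bar>y - x m\<bar>) = \<bar>y - x 0\<bar> * (\<Prod>m\<in>{1..s}. \<bar>y - x m\<bar>)" by simp
  moreover have "(\<Prod>m\<in>{1..s}. \<bar>y - x m\<bar>) \<le> (\<Prod>m\<in>{1..s}. \<delta> + h)"
  proof (intro prod_mono conjI)
    fix m assume "m \<in> {1..s}"
    then show "\<bar>y - x m\<bar> \<le> \<delta> + h" using x[of m] assms(3) by linarith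
  qed simp
  then have "(\<Prod>m\<in>{1..s}. \<bar>y - x m\<bar>) \<le> (\<delta> + h) ^ s" by simp
  ultimately show ?thesis using assms by (auto intro!: mult_mono prod_nonneg)
qed

lemma bunched_sampling_set_nodes:
  assumes "bunched_sampling_set I s x r \<delta> h" "n \<in> I" "m \<le> s"
  shows "x n m \<in> voronoi I (\<lambda>n. x n 0) n"
  using assms by (cases "m = 0") (auto simp: bunched_sampling_set_def voronoi_def[of I _ n] subset_iff)

lemma bunched_sampling_set_width:
  assumes "bunched_sampling_set I s x r \<delta> h" "n \<in> I" "m \<in> {1..s}"
  shows "\<bar>x n m - x n 0\<bar> \<le> h"
proof -
  have "ennreal (r n) \<le> (SUP n\<in>I. ennreal (r n))" using assms(2) by (rule SUP_upper)
  then have "r n \<le> h" using assms(1) by (simp add: bunched_sampling_set_def ennreal_le_iff)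
  moreover have "x n m \<in> {x n 0 - r n .. x n 0 + r n}" using assms unfolding bunched_sampling_set_def by blast
  ultimately show ?thesis by auto
qed

text \<open>Almost every \<open>y\<close> lies in exactly one \<open>V n\<close>, so the indicators sum to 1 there. Countability of the
index set allows the sum and the integral to be interchanged.\<close>
lemma has_sum_set_integral_partition:
  fixes \<phi> :: "real \<Rightarrow> real"
  assumes I: "countable I" and V: "\<And>n. n \<in> I \<Longrightarrow> V n \<in> sets borel"
    and disj: "\<And>n l. n \<in> I \<Longrightarrow> l \<in> I \<Longrightarrow> n \<noteq> l \<Longrightarrow> V n \<inter> V l \<in> null_sets lborel"
    and cover: "- (\<Union>n\<in>I. V n) \<in> null_sets lborel"
    and \<phi>: "integrable lborel \<phi>" and \<phi>0: "\<And>y. 0 \<le> \<phi> y"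
  shows "((\<lambda>n. LINT y:V n|lborel. \<phi> y) has_sum (LINT y|lborel. \<phi> y)) I"
proof -
  have [measurable]: "\<phi> \<in> borel_measurable borel" using \<phi> by (auto dest: borel_measurable_integrable)
  have Vint: "integrable lborel (\<lambda>y. indicator (V n) y *\<^sub>R \<phi> y)" if "n \<in> I" for n
    using V[OF that] by (intro integrable_mult_indicator \<phi>) simp
  have ae1: "AE y in lborel. y \<in> (\<Union>n\<in>I. V n)"
    using AE_not_in[OF cover] by eventually_elim auto
  have ae2: "AE y in lborel. \<forall>n\<in>I. \<forall>l\<in>I. n \<noteq> l \<longrightarrow> y \<notin> V n \<inter> V l"
  proof (simp only: AE_ball_countable[OF I], intro ballI)
    fix n l assume "n \<in> I" "l \<in> I"
    show "AE y in lborel. n \<noteq> l \<longrightarrow> y \<notin> V n \<inter> V l"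
      using AE_not_in[OF disj[OF \<open>n \<in> I\<close> \<open>l \<in> I\<close>]] by (cases "n = l") auto
  qed
  have one: "AE y in lborel. (\<integral>\<^sup>+n. ennreal (indicator (V n) y *\<^sub>R \<phi> y) \<partial>count_space I) = ennreal (\<phi> y)"
    using ae1 ae2
  proof eventually_elim
    case (elim y)
    then obtain n where n: "n \<in> I" "y \<in> V n" by blast
    have "(\<integral>\<^sup>+l. ennreal (indicator (V l) y *\<^sub>R \<phi> y) \<partial>count_space I) = (\<Sum>l\<in>{n}. ennreal (indicator (V l) y *\<^sub>R \<phi> y))"
      using elim(2) n by (intro nn_integral_count_space') (auto simp: indicator_def)
    then show ?case using n by simp
  qed
  have "(\<integral>\<^sup>+n. ennreal (LINT y:V n|lborel. \<phi> y) \<partial>count_space I) =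
      (\<integral>\<^sup>+n. \<integral>\<^sup>+y. ennreal (indicator (V n) y *\<^sub>R \<phi> y) \<partial>lborel \<partial>count_space I)"
    unfolding set_lebesgue_integral_def using Vint \<phi>0
    by (intro nn_integral_cong nn_integral_eq_integral[symmetric]) auto
  also have "\<dots> = (\<integral>\<^sup>+y. \<integral>\<^sup>+n. ennreal (indicator (V n) y *\<^sub>R \<phi> y) \<partial>count_space I \<partial>lborel)"
    using V by (intro nn_integral_count_space_nn_integral[symmetric] I) auto
  also have "\<dots> = (\<integral>\<^sup>+y. ennreal (\<phi> y) \<partial>lborel)"
    by (rule nn_integral_cong_AE[OF one])
  also have "\<dots> = ennreal (LINT y|lborel. \<phi> y)"
    using \<phi> \<phi>0 by (intro nn_integral_eq_integral) auto
  finally have nn: "(\<integral>\<^sup>+n. ennreal (LINT y:V n|lborel. \<phi> y) \<partial>count_space I) = ennreal (LINT y|lborel. \<phi> y)" .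
  have pos: "0 \<le> (LINT y:V n|lborel. \<phi> y)" for n
    unfolding set_lebesgue_integral_def using \<phi>0 by (intro integral_nonneg_AE) auto
  have abs: "Infinite_Set_Sum.abs_summable_on (\<lambda>n. LINT y:V n|lborel. \<phi> y) I"
    unfolding abs_summable_on_def using nn pos by (intro integrableI_nonneg) auto
  have "infsetsum (\<lambda>n. LINT y:V n|lborel. \<phi> y) I = (LINT y|lborel. \<phi> y)"
    using nn pos \<phi>0 by (subst infsetsum_conv_nn_integral) (auto intro!: integral_nonneg_AE)
  then show ?thesis
    using infsetsum_infsum[OF abs] abs_summable_summable[OF abs_summable_equivalent[THEN iffD2, OF abs]]
    by (simp add: has_sum_iff)
qed

section \<open>The density condition\<close>

lemma h_tilde_strict_mono:
  assumes "0 < \<tau>" "0 \<le> y" "y < z"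
  shows "h_tilde s \<tau> y < h_tilde s \<tau> z"
proof -
  have "y ^ (s + 1) < z ^ (s + 1)" using assms by (intro power_strict_mono) auto
  then have "(1 + \<tau>) ^ s * y ^ (s + 1) / fact (s + 1) < (1 + \<tau>) ^ s * z ^ (s + 1) / fact (s + 1)"
    using assms by (intro divide_strict_right_mono mult_strict_left_mono) auto
  then show ?thesis
    unfolding h_tilde_def using assms
    by (intro mult_less_le_imp_less) (auto intro!: divide_right_mono add_pos_nonneg)
qed

text \<open>The value 1 is attained by the intermediate value theorem, since \<open>h_tilde\<close> is 0 at 0 and at least 1 at
\<open>(s + 1)!\<close>.\<close>
lemma H_tilde_one:
  assumes \<tau>: "0 < \<tau>"
  shows "0 < H_tilde s \<tau> 1" "h_tilde s \<tau> (H_tilde s \<tau> 1) = 1"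
proof -
  let ?h = "h_tilde s \<tau>"
  let ?Z = "fact (s + 1) :: real"
  have Z1: "1 \<le> ?Z" by (rule fact_ge_1)
  have "1 \<le> ?h ?Z"
  proof -
    have "?Z ^ 1 \<le> ?Z ^ (s + 1)" using Z1 by (intro power_increasing) auto
    moreover have "1 * ?Z ^ (s + 1) \<le> (1 + \<tau>) ^ s * ?Z ^ (s + 1)"
      using \<tau> Z1 by (intro mult_right_mono one_le_power) auto
    ultimately have "?Z \<le> (1 + \<tau>) ^ s * ?Z ^ (s + 1)" unfolding power_one_right mult_1_left by linarith
    then have "1 \<le> (1 + \<tau>) ^ s * ?Z ^ (s + 1) / ?Z" using Z1 by (subst le_divide_eq) auto
    moreover have "1 \<le> 1 + 4 * ?Z / pi" by simp
    ultimately show ?thesis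
      unfolding h_tilde_def
      using mult_mono[of 1 "(1 + \<tau>) ^ s * ?Z ^ (s + 1) / ?Z" 1 "1 + 4 * ?Z / pi"] by linarith
  qed
  moreover have "?h 0 \<le> 1" by (simp add: h_tilde_def)
  moreover have "continuous_on {0..?Z} ?h"
    unfolding h_tilde_def by (intro continuous_intros) auto
  ultimately obtain z where z: "0 \<le> z" "?h z = 1"
    using IVT'[of ?h 0 1 ?Z] Z1 by auto
  have "z \<noteq> 0" using z(2) by (auto simp: h_tilde_def)
  then have z0: "0 < z" using z by simp
  have "inj_on ?h {0<..}"
    using h_tilde_strict_mono[OF \<tau>] by (intro linorder_inj_onI) (force simp: less_le)+
  then have "H_tilde s \<tau> 1 = z"
    unfolding H_tilde_def using z z0 by (intro the_inv_into_f_eq) auto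
  then show "0 < H_tilde s \<tau> 1" "?h (H_tilde s \<tau> 1) = 1" using z0 z by auto
qed

lemma abs_le_max_freq:
  assumes "compact \<Omega>" "\<omega> \<in> \<Omega>"
  shows "\<bar>\<omega>\<bar> \<le> enn2real (max_freq \<Omega>)"
proof -
  obtain B where B: "\<And>\<omega>. \<omega> \<in> \<Omega> \<Longrightarrow> \<bar>\<omega>\<bar> \<le> B"
    using compact_imp_bounded[OF assms(1)] unfolding bounded_iff by auto
  have "max_freq \<Omega> \<le> ennreal B"
    unfolding max_freq_def using B by (intro SUP_least ennreal_leI) auto
  then have "max_freq \<Omega> < top" by (simp add: le_less_trans[OF _ ennreal_less_top])
  moreover have "ennreal \<bar>\<omega>\<bar> \<le> max_freq \<Omega>"
    unfolding max_freq_def using assms(2) by (rule SUP_upper)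
  ultimately have "enn2real (ennreal \<bar>\<omega>\<bar>) \<le> enn2real (max_freq \<Omega>)" by (intro enn2real_mono)
  then show ?thesis by simp
qed

text \<open>The condition says \<open>\<delta> m < H_tilde s \<tau> 1\<close>: for \<open>m = 0\<close> this is positivity of the right-hand side, for
\<open>m > 0\<close> the quotient is one of real numbers. Monotonicity of \<open>h_tilde\<close> does the rest.\<close>
lemma h_tilde_less_one:
  assumes \<tau>: "0 < \<tau>" and \<delta>: "0 \<le> \<delta>" "ennreal \<delta> < ennreal (H_tilde s \<tau> 1) / max_freq \<Omega>"
    and m: "m = enn2real (max_freq \<Omega>)"
  shows "h_tilde s \<tau> (\<delta> * m) < 1"
proof -
  have m0: "0 \<le> m" by (simp add: m)
  have "\<delta> * m < H_tilde s \<tau> 1"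
  proof (cases "m = 0")
    case True
    then show ?thesis using H_tilde_one[OF \<tau>] by simp
  next
    case False
    then have "max_freq \<Omega> < top" using m by (cases "max_freq \<Omega>") auto
    then have "max_freq \<Omega> = ennreal m" using m by (simp add: ennreal_enn2real)
    then have "ennreal \<delta> < ennreal (H_tilde s \<tau> 1 / m)"
      using \<delta>(2) False m0 H_tilde_one(1)[OF \<tau>, of s] by (simp add: divide_ennreal)
    then have "\<delta> < H_tilde s \<tau> 1 / m" using \<delta>(1) by (simp add: ennreal_less_iff)
    then show ?thesis using False m0 by (simp add: field_simps)
  qed
  then show ?thesis
    using h_tilde_strict_mono[OF \<tau>, of "\<delta> * m" "H_tilde s \<tau> 1" s] H_tilde_one(2)[OF \<tau>, of s] \<delta> m0 by simp
qed

section \<open>The fusion frame\<close>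

text \<open>The triangle inequality in both directions for families of squared norms \<open>p n\<close> and \<open>d n\<close> with squared
distances \<open>e n\<close>.\<close>
lemma frame_bounds_of_perturbation:
  fixes p e d :: "'i \<Rightarrow> real"
  assumes nonneg: "\<And>n. n \<in> I \<Longrightarrow> 0 \<le> p n" "\<And>n. n \<in> I \<Longrightarrow> 0 \<le> e n"
    and pd: "\<And>n t. n \<in> I \<Longrightarrow> 0 < t \<Longrightarrow> p n \<le> (1 + t) * d n + (1 + 1 / t) * e n"
    and dp: "\<And>n t. n \<in> I \<Longrightarrow> 0 < t \<Longrightarrow> d n \<le> (1 + t) * p n + (1 + 1 / t) * e n"
    and d: "(d has_sum N) I" and e: "(e has_sum E) I" and E: "E \<le> h\<^sup>2 * N" and h: "0 \<le> h" "h \<le> 1" and N: "0 \<le> N"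
  shows "p summable_on I" "(1 - h)\<^sup>2 * N \<le> infsum p I" "infsum p I \<le> (1 + h)\<^sup>2 * N"
proof -
  have up: "((\<lambda>n. (1 + t) * d n + (1 + 1 / t) * e n) has_sum ((1 + t) * N + (1 + 1 / t) * E)) I" for t
    by (intro has_sum_add has_sum_cmult_right d e)
  show sp: "p summable_on I"
  proof (rule summable_on_comparison_test)
    show "(\<lambda>n. (1 + 1) * d n + (1 + 1 / 1) * e n) summable_on I" using up[of 1] by (rule has_sum_imp_summable)
  qed (use nonneg pd[of _ 1] in auto)
  then have P: "(p has_sum infsum p I) I" by simp
  have P0: "0 \<le> infsum p I" using nonneg by (intro infsum_nonneg)
  have E0: "0 \<le> E" using has_sum_nonneg[OF e] nonneg by auto
  have sE: "sqrt E \<le> h * sqrt N" using real_sqrt_le_mono[OF E] h N by (simp add: real_sqrt_mult)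
  have "infsum p I \<le> (sqrt N + sqrt E)\<^sup>2"
  proof (rule le_power2_sum_if_le_weighted)
    fix t :: real assume "0 < t"
    then show "infsum p I \<le> (1 + t) * (sqrt N)\<^sup>2 + (1 + 1 / t) * (sqrt E)\<^sup>2"
      using has_sum_mono[OF P up[of t] pd] N E0 by simp
  qed (use N E0 in auto)
  also have "\<dots> \<le> (sqrt N + h * sqrt N)\<^sup>2" using sE N E0 by (intro power_mono) auto
  also have "\<dots> = (1 + h)\<^sup>2 * N" using N by (simp add: power2_eq_square algebra_simps)
  finally show "infsum p I \<le> (1 + h)\<^sup>2 * N" .
  have lo: "((\<lambda>n. (1 + t) * p n + (1 + 1 / t) * e n) has_sum ((1 + t) * infsum p I + (1 + 1 / t) * E)) I" for t
    by (intro has_sum_add has_sum_cmult_right P e)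
  have "N \<le> (sqrt (infsum p I) + sqrt E)\<^sup>2"
  proof (rule le_power2_sum_if_le_weighted)
    fix t :: real assume "0 < t"
    then show "N \<le> (1 + t) * (sqrt (infsum p I))\<^sup>2 + (1 + 1 / t) * (sqrt E)\<^sup>2"
      using has_sum_mono[OF d lo[of t] dp] P0 E0 by simp
  qed (use P0 E0 in auto)
  then have "sqrt N \<le> sqrt (infsum p I) + sqrt E"
    using P0 E0 by (intro real_le_lsqrt) auto
  then have "(1 - h) * sqrt N \<le> sqrt (infsum p I)" using sE by (simp add: algebra_simps)
  then have "((1 - h) * sqrt N)\<^sup>2 \<le> (sqrt (infsum p I))\<^sup>2" using h N by (intro power_mono) auto
  then show "(1 - h)\<^sup>2 * N \<le> infsum p I" using N P0 by (simp add: power_mult_distrib)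
qed

lemma set_integral_Icc_continuous:
  fixes g :: "real \<Rightarrow> real"
  assumes "continuous_on UNIV g"
  shows "(LINT y:{a..b}|lborel. g y) = integral {a..b} g"
  using assms by (intro set_borel_integral_eq_integral(2) borel_integrable_atLeastAtMost') (rule continuous_on_subset, auto)

text \<open>By uniqueness, the interpolant is linear in the node values, and the image of \<open>f\<close> has the same node
values as \<open>f\<close>, because the nodes lie in the region whose indicator is applied.\<close>
lemma sampling_proj_projection:
  assumes B: "bunched_sampling_set I s x r \<delta> h" and n: "n \<in> I"
  shows "projection_on S (sampling_proj I s x n)"
proof -
  have inj: "inj_on (x n) {..s}" using B n by (simp add: bunched_sampling_set_def)
  have lin: "interp_poly s (x n) (\<lambda>y. a * f y + b * g y) = smult a (interp_poly s (x n) f) + smult b (interp_poly s (x n) g)" for a b f g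
    using interp_poly(1)[OF inj] interp_poly(2)[OF inj]
    by (intro interp_poly_eqI[OF inj] degree_add_le order_trans[OF degree_smult_le]) auto
  have idem: "interp_poly s (x n) (sampling_proj I s x n f) = interp_poly s (x n) f" for f
    using interp_poly(1)[OF inj] bunched_sampling_set_nodes[OF B n]
    by (intro interp_poly_eqI[OF inj]) (auto simp: sampling_proj_def)
  show ?thesis
    unfolding projection_on_def
  proof (intro conjI ballI allI)
    show "sampling_proj I s x n (\<lambda>y. a * f y + b * g y) = (\<lambda>y. a * sampling_proj I s x n f y + b * sampling_proj I s x n g y)" for f g a b
      by (simp add: sampling_proj_def lin fun_eq_iff algebra_simps)
    show "sampling_proj I s x n (sampling_proj I s x n f) = sampling_proj I s x n f" for f
      using idem[of f] unfolding sampling_proj_def[of I s x n "sampling_proj I s x n f"] by (simp add: sampling_proj_def)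
  qed
qed

text \<open>The local errors are summed over the regions for each fixed \<open>t\<close>; choosing \<open>t\<close> and applying
Bernstein's inequality gives the total error \<open>\<eta>\<^sup>2 \<parallel>f\<parallel>\<^sup>2\<close>.\<close>
lemma sampling_proj_frame_bounds:
  assumes \<Omega>: "compact \<Omega>" and \<tau>: "0 < \<tau>" and B: "bunched_sampling_set I s x r \<delta> (\<tau> * \<delta>)"
    and m: "m = enn2real (max_freq \<Omega>)"
    and \<eta>: "\<eta> = (1 + \<tau>) ^ s * (\<delta> * m) ^ (s + 1) / fact (s + 1) * (1 + 4 * \<delta> * m / pi)" and \<eta>1: "\<eta> < 1"
  shows "fusion_frame_bounds (bandlimited \<Omega>) I (sampling_proj I s x) (\<lambda>_. 1) ((1 - \<eta>)\<^sup>2) ((1 + \<eta>)\<^sup>2)"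
proof -
  let ?V = "voronoi I (\<lambda>n. x n 0)"
  have \<delta>: "0 \<le> \<delta>" "sampling_density I (\<lambda>n. x n 0) = ennreal \<delta>" and I: "countable I"
    and disj: "\<And>n l. n \<in> I \<Longrightarrow> l \<in> I \<Longrightarrow> n \<noteq> l \<Longrightarrow> ?V n \<inter> ?V l \<in> null_sets lborel"
    and cover: "- (\<Union>n\<in>I. ?V n) \<in> null_sets lborel"
    and inj: "\<And>n. n \<in> I \<Longrightarrow> inj_on (x n) {..s}"
    using B unfolding bunched_sampling_set_def by auto
  have m0: "0 \<le> m" by (simp add: m)
  have \<eta>0: "0 \<le> \<eta>" unfolding \<eta> using \<tau> \<delta> m0 by simp
  obtain a b where ab: "\<And>n. n \<in> I \<Longrightarrow> a n \<le> b n" "\<And>n. n \<in> I \<Longrightarrow> b n - a n \<le> 2 * \<delta>" "\<And>n. n \<in> I \<Longrightarrow> ?V n = {a n..b n}"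
    using voronoi_eq_interval[OF \<delta>] by metis
  have Vb: "?V n \<in> sets borel" if "n \<in> I" for n using ab(3)[OF that] by simp
  let ?Q = "\<delta> * (\<delta> + \<tau> * \<delta>) ^ s"
  let ?K = "?Q / fact (Suc s)"
  have Q: "(\<Prod>m\<le>s. \<bar>y - x n m\<bar>) \<le> ?Q" if "n \<in> I" "y \<in> {a n..b n}" for n y
    using that \<tau> \<delta>(1) ab(3) voronoi_within_density[OF \<delta> that(1), of y] bunched_sampling_set_width[OF B that(1)]
    by (intro nodal_product_le) auto
  have K0: "0 \<le> ?K" using \<delta> \<tau> by simp
  have \<eta>K: "\<eta> = ?K * (m ^ Suc s + 4 * \<delta> / pi * m ^ Suc (Suc s))"
  proof -
    have "\<delta> + \<tau> * \<delta> = (1 + \<tau>) * \<delta>" by (simp add: algebra_simps)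
    then have Q_eq: "?Q = (1 + \<tau>) ^ s * \<delta> ^ Suc s"
      by (simp only: power_mult_distrib power_Suc mult_ac)
    show ?thesis unfolding \<eta> Q_eq by (simp add: power_mult_distrib field_simps)
  qed
  show ?thesis
    unfolding fusion_frame_bounds_def
  proof (intro conjI ballI)
    show "0 < (1 - \<eta>)\<^sup>2" "0 < (1 + \<eta>)\<^sup>2" using \<eta>0 \<eta>1 by auto
    fix f assume "f \<in> bandlimited \<Omega>"
    then obtain g D where f2: "square_integrable f" and fg: "has_L2_fourier_transform f g" and supp: "ess_support g \<subseteq> \<Omega>"
      and D0: "D 0 = f" and D: "\<And>k y. (D k has_vector_derivative D (Suc k) y) (at y)"
      unfolding bandlimited_def smooth_def by blast
    have supp': "AE \<omega> in lborel. m < \<bar>\<omega>\<bar> \<longrightarrow> g \<omega> = 0"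
      using AE_zero_outside_ess_support[of g]
    proof eventually_elim
      case (elim \<omega>)
      then show ?case using supp abs_le_max_freq[OF \<Omega>, of \<omega>] m by force
    qed
    note bern = bernstein_inequality[OF fg supp' m0 D0 D]
    define N where "N = (LINT y|lborel. (norm (f y))\<^sup>2)"
    define S where "S k = (LINT y|lborel. (norm (D k y))\<^sup>2)" for k
    have N0: "0 \<le> N" by (simp add: N_def)
    have S: "0 \<le> S k" "S k \<le> (m ^ k)\<^sup>2 * N" for k
      using bern(2)[of k] by (simp_all add: S_def N_def)
    have Dc: "continuous_on UNIV (D k)" for k
      using D by (intro continuous_at_imp_continuous_on ballI has_vector_derivative_continuous)
    define d where "d k n = (LINT y:?V n|lborel. (norm (D k y))\<^sup>2)" for k n
    have d: "(d k has_sum S k) I" for k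
      unfolding d_def S_def by (rule has_sum_set_integral_partition[OF I Vb disj cover bern(1)]) auto
    have d_eq: "d k n = integral {a n..b n} (\<lambda>y. (norm (D k y))\<^sup>2)" if "n \<in> I" for k n
      unfolding d_def ab(3)[OF that] by (intro set_integral_Icc_continuous continuous_intros Dc)
    define q where "q n y = poly (interp_poly s (x n) f) (complex_of_real y)" for n y
    have qc: "continuous_on A (q n)" for n A
      unfolding q_def by (intro continuous_intros)
    define p where "p n = integral {a n..b n} (\<lambda>y. (norm (q n y))\<^sup>2)" for n
    define e where "e n = integral {a n..b n} (\<lambda>y. (norm (D 0 y - q n y))\<^sup>2)" for n
    have int: "(\<lambda>y. (norm (D 0 y))\<^sup>2) integrable_on {a n..b n}" "(\<lambda>y. (norm (q n y))\<^sup>2) integrable_on {a n..b n}"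
       "(\<lambda>y. (norm (D 0 y - q n y))\<^sup>2) integrable_on {a n..b n}" for n
      by (intro integrable_continuous_real continuous_intros qc continuous_on_subset[OF Dc]; simp)+
    have p0: "0 \<le> p n" and e0: "0 \<le> e n" for n
      unfolding p_def e_def by (auto intro!: integral_nonneg int)
    have combine: "(1 + t) * integral {a n..b n} F + (1 + 1 / t) * integral {a n..b n} G = integral {a n..b n} (\<lambda>y. (1 + t) * F y + (1 + 1 / t) * G y)"
      and combine_int: "(\<lambda>y. (1 + t) * F y + (1 + 1 / t) * G y) integrable_on {a n..b n}"
      if "F integrable_on {a n..b n}" "G integrable_on {a n..b n}" for t n and F G :: "real \<Rightarrow> real"
    proof -
      have "((\<lambda>y. (1 + t) * F y + (1 + 1 / t) * G y) has_integral (1 + t) * integral {a n..b n} F + (1 + 1 / t) * integral {a n..b n} G) {a n..b n}"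
        using that by (intro has_integral_add has_integral_mult_right integrable_integral)
      then show "(1 + t) * integral {a n..b n} F + (1 + 1 / t) * integral {a n..b n} G = integral {a n..b n} (\<lambda>y. (1 + t) * F y + (1 + 1 / t) * G y)"
        "(\<lambda>y. (1 + t) * F y + (1 + 1 / t) * G y) integrable_on {a n..b n}"
        by (auto simp: has_integral_iff)
    qed
    have pd: "p n \<le> (1 + t) * d 0 n + (1 + 1 / t) * e n" if "n \<in> I" "0 < t" for n t
      unfolding p_def d_eq[OF that(1)] e_def combine[OF int(1,3)]
      using norm_power2_le_weighted[OF that(2), of "q n _" "D 0 _"]
      by (intro integral_le int combine_int) (simp add: norm_minus_commute)
    have dp: "d 0 n \<le> (1 + t) * p n + (1 + 1 / t) * e n" if "n \<in> I" "0 < t" for n t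
      unfolding p_def d_eq[OF that(1)] e_def combine[OF int(2,3)]
      using norm_power2_le_weighted[OF that(2)] by (intro integral_le int combine_int)
    define W where "W t n = ?K\<^sup>2 * ((1 + t) * d (Suc s) n + (1 + 1 / t) * ((4 * \<delta> / pi)\<^sup>2 * d (Suc (Suc s)) n))" for t n
    have W: "(W t has_sum ?K\<^sup>2 * ((1 + t) * S (Suc s) + (1 + 1 / t) * ((4 * \<delta> / pi)\<^sup>2 * S (Suc (Suc s))))) I" for t
      unfolding W_def by (intro has_sum_cmult_right has_sum_add d)
    have eW: "e n \<le> W t n" if n: "n \<in> I" and t: "0 < t" for n t
      unfolding e_def W_def d_eq[OF n] q_def
    proof (rule local_interpolation_error[where D = D and x = "x n" and t = t])
      show "inj_on (x n) {..s}" "a n \<le> b n" "b n - a n \<le> 2 * \<delta>" "0 < t"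
        by (fact inj[OF n] ab(1)[OF n] ab(2)[OF n] t)+
      show "(\<Prod>m\<le>s. \<bar>y - x n m\<bar>) \<le> ?Q" if "y \<in> {a n..b n}" for y by (rule Q[OF n that])
      show "(D k has_vector_derivative D (Suc k) y) (at y)" for k y by (rule D)
      show "degree (interp_poly s (x n) f) \<le> s" by (rule interp_poly(1)[OF inj[OF n]])
      show "poly (interp_poly s (x n) f) (complex_of_real (x n m)) = D 0 (x n m)" if "m \<le> s" for m
        unfolding D0 by (rule interp_poly(2)[OF inj[OF n] that])
      show "x n m \<in> {a n..b n}" if "m \<le> s" for m
        using bunched_sampling_set_nodes[OF B n that] ab(3)[OF n] by simp
    qed
    have "e summable_on I"
      by (rule summable_on_comparison_test[OF has_sum_imp_summable[OF W[of 1]]]) (auto intro: eW e0)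
    then have e: "(e has_sum infsum e I) I" by simp
    \<comment> \<open>Only here, after summation over all regions, is the weight \<open>t\<close> chosen.\<close>
    have "infsum e I \<le> (?K * sqrt (S (Suc s)) + ?K * (4 * \<delta> / pi) * sqrt (S (Suc (Suc s))))\<^sup>2"
    proof (rule le_power2_sum_if_le_weighted)
      show "0 \<le> ?K * sqrt (S (Suc s))" using K0 S by (intro mult_nonneg_nonneg) auto
      show "0 \<le> ?K * (4 * \<delta> / pi) * sqrt (S (Suc (Suc s)))" using K0 S \<delta> by (intro mult_nonneg_nonneg) auto
      fix t :: real assume t: "0 < t"
      have "infsum e I \<le> ?K\<^sup>2 * ((1 + t) * S (Suc s) + (1 + 1 / t) * ((4 * \<delta> / pi)\<^sup>2 * S (Suc (Suc s))))"
        by (rule has_sum_mono[OF e W eW[OF _ t]])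
      also have "\<dots> = (1 + t) * (?K * sqrt (S (Suc s)))\<^sup>2 + (1 + 1 / t) * (?K * (4 * \<delta> / pi) * sqrt (S (Suc (Suc s))))\<^sup>2"
        unfolding power_mult_distrib using S by (simp only: real_sqrt_pow2) (simp add: algebra_simps)
      finally show "infsum e I \<le> (1 + t) * (?K * sqrt (S (Suc s)))\<^sup>2 + (1 + 1 / t) * (?K * (4 * \<delta> / pi) * sqrt (S (Suc (Suc s))))\<^sup>2" .
    qed
    also have "\<dots> \<le> (?K * (m ^ Suc s * sqrt N) + ?K * (4 * \<delta> / pi) * (m ^ Suc (Suc s) * sqrt N))\<^sup>2"
    proof -
      have sS: "sqrt (S k) \<le> m ^ k * sqrt N" for k
        using real_sqrt_le_mono[OF S(2)[of k]] m0 by (simp add: real_sqrt_mult)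
      show ?thesis
        using K0 S \<delta> by (intro power_mono add_mono mult_left_mono sS add_nonneg_nonneg mult_nonneg_nonneg) auto
    qed
    also have "\<dots> = (\<eta> * sqrt N)\<^sup>2" unfolding \<eta>K by (simp only: distrib_left distrib_right mult.assoc)
    also have "\<dots> = \<eta>\<^sup>2 * N" using N0 by (simp add: power_mult_distrib)
    finally have E: "infsum e I \<le> \<eta>\<^sup>2 * N" .
    have SN: "S 0 = N" by (simp add: S_def N_def D0)
    \<comment> \<open>The piecewise interpolant lies within \<open>\<eta> * sqrt N\<close> of \<open>f\<close>, whose squared norm is \<open>N\<close>.\<close>
    have bounds: "p summable_on I" "(1 - \<eta>)\<^sup>2 * N \<le> infsum p I" "infsum p I \<le> (1 + \<eta>)\<^sup>2 * N"
      using frame_bounds_of_perturbation[OF p0 e0 pd dp d[of 0, unfolded SN] e E \<eta>0 less_imp_le[OF \<eta>1] N0]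
      by auto
    have proj_sq: "(norm (sampling_proj I s x n f y))\<^sup>2 = indicator {a n..b n} y *\<^sub>R (norm (q n y))\<^sup>2" if "n \<in> I" for n y
      by (simp add: sampling_proj_def q_def norm_mult ab(3)[OF that] indicator_def)
    have proj_norm: "(L2_norm (sampling_proj I s x n f))\<^sup>2 = p n" if "n \<in> I" for n
    proof -
      have "(LINT y|lborel. (norm (sampling_proj I s x n f y))\<^sup>2) = (LINT y:{a n..b n}|lborel. (norm (q n y))\<^sup>2)"
        unfolding proj_sq[OF that] set_lebesgue_integral_def ..
      also have "\<dots> = p n" unfolding p_def by (intro set_integral_Icc_continuous continuous_intros qc)
      finally show ?thesis using p0[of n] by (simp add: L2_norm_def)
    qed
    have f_norm: "(L2_norm f)\<^sup>2 = N" using N0 by (simp add: L2_norm_def N_def)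
    show "square_integrable (sampling_proj I s x n f)" if n: "n \<in> I" for n
    proof -
      have [measurable]: "q n \<in> borel_measurable borel" by (rule borel_measurable_continuous_onI[OF qc])
      have "sampling_proj I s x n f = (\<lambda>y. q n y * indicator {a n..b n} y)"
        by (simp add: sampling_proj_def q_def ab(3)[OF n])
      then have "sampling_proj I s x n f \<in> borel_measurable lborel" by simp
      moreover have "set_integrable lborel {a n..b n} (\<lambda>y. (norm (q n y))\<^sup>2)"
        by (intro borel_integrable_atLeastAtMost' continuous_intros qc)
      ultimately show ?thesis unfolding square_integrable_def proj_sq[OF n] set_integrable_def by simp
    qed
    have cong: "1 * (L2_norm (sampling_proj I s x n f))\<^sup>2 = p n" if "n \<in> I" for n using proj_norm[OF that] by simp
    show "(\<lambda>n. 1 * (L2_norm (sampling_proj I s x n f))\<^sup>2) summable_on I"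
      by (rule summable_on_cong[where g = p, THEN iffD2, OF cong bounds(1)])
    have inf: "(\<Sum>\<^sub>\<infinity>n\<in>I. 1 * (L2_norm (sampling_proj I s x n f))\<^sup>2) = infsum p I"
      by (rule infsum_cong) (rule cong)
    show "(1 - \<eta>)\<^sup>2 * (L2_norm f)\<^sup>2 \<le> (\<Sum>\<^sub>\<infinity>n\<in>I. 1 * (L2_norm (sampling_proj I s x n f))\<^sup>2)"
      "(\<Sum>\<^sub>\<infinity>n\<in>I. 1 * (L2_norm (sampling_proj I s x n f))\<^sup>2) \<le> (1 + \<eta>)\<^sup>2 * (L2_norm f)\<^sup>2"
      unfolding f_norm inf by (fact bounds(2,3))+
  qed
qed

(* The quotient is taken in [0, \<infinity>], where a positive number divided by 0 is \<infinity>. *)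
theorem theorem4p1:
  fixes \<Omega> :: "real set" and s :: nat and I :: "'i set"
    and x :: "'i \<Rightarrow> nat \<Rightarrow> real" and r :: "'i \<Rightarrow> real" and \<delta> \<tau> m :: real
  assumes "compact \<Omega>"
    and "0 < \<tau>" "\<tau> \<le> 1"
    and "bunched_sampling_set I s x r \<delta> (\<tau> * \<delta>)"
    and "ennreal \<delta> < ennreal (H_tilde s \<tau> 1) / max_freq \<Omega>"
    and "m = enn2real (max_freq \<Omega>)"
  shows "(\<exists>A B.
      fusion_frame_bounds (bandlimited \<Omega>) I (sampling_proj I s x) (\<lambda>_. 1) A B \<and>
      A \<ge> (1 - (1 + \<tau>) ^ s * (\<delta> * m) ^ (s + 1) / fact (s + 1) * (1 + 4 * \<delta> * m / pi))\<^sup>2 \<and>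
      B \<le> (1 + (1 + \<tau>) ^ s * (\<delta> * m) ^ (s + 1) / fact (s + 1) * (1 + 4 * \<delta> * m / pi))\<^sup>2) \<and>
    nonorthogonal_fusion_frame (bandlimited \<Omega>) I (sampling_proj I s x) (\<lambda>_. 1)"
proof -
  let ?\<eta> = "(1 + \<tau>) ^ s * (\<delta> * m) ^ (s + 1) / fact (s + 1) * (1 + 4 * \<delta> * m / pi)"
  have "0 \<le> \<delta>" using assms(4) by (simp add: bunched_sampling_set_def)
  then have "?\<eta> < 1"
    using h_tilde_less_one[OF assms(2) _ assms(5,6)] by (simp add: h_tilde_def mult.assoc)
  then have bounds: "fusion_frame_bounds (bandlimited \<Omega>) I (sampling_proj I s x) (\<lambda>_. 1) ((1 - ?\<eta>)\<^sup>2) ((1 + ?\<eta>)\<^sup>2)"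
    by (intro sampling_proj_frame_bounds[OF assms(1,2,4,6)]) auto
  show ?thesis
  proof
    show "\<exists>A B. fusion_frame_bounds (bandlimited \<Omega>) I (sampling_proj I s x) (\<lambda>_. 1) A B \<and> A \<ge> (1 - ?\<eta>)\<^sup>2 \<and> B \<le> (1 + ?\<eta>)\<^sup>2"
      using bounds by blast
    show "nonorthogonal_fusion_frame (bandlimited \<Omega>) I (sampling_proj I s x) (\<lambda>_. 1)"
      unfolding nonorthogonal_fusion_frame_def
      using bounds sampling_proj_projection[OF assms(4)] by auto
  qed
qed

end
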